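(* For all $\lambda\vdash n$ and all simple connected bipartite graphs $G$ on $n$ vertices, $$b_{1^n,r}(L_G)\le \frac{b_{\lambda,r}(L_G)}{\chi_\lambda(\mathrm{id})}\le b_{n,r}(L_G)\quad\text{for } r=0,1,2,\dots,n.$$
   Context: For $\lambda\vdash n$, $\chi_\lambda$ is the irreducible complex character of the symmetric group $\mathfrak{S}_n$ indexed by $\lambda$; $\lambda=1^n$ gives the sign character and $\lambda=n$ (the one-part partition) the trivial character. The immanant of a complex $n\times n$ matrix $A=(a_{i,j})$ is $\mathrm{imm}_\lambda(A)=\sum_{\psi\in\mathfrak{S}_n}\chi_\lambda(\psi)\prod_{i=1}^n a_{i,\psi(i)}$. The Laplacian of $G$ is $L_G=D-A(G)$ ($D$ the diagonal degree matrix, $A(G)$ the adjacency matrix), and $b_{\lambda,r}(L_G)$ is defined by $\mathrm{imm}_\lambda(xI-L_G)=\sum_{r=0}^n(-1)^r b_{\lambda,r}(L_G)x^{n-r}$. *)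

theory Defs
  imports
    "HOL-Combinatorics.Permutations"
    "HOL-Computational_Algebra.Polynomial"
    "HOL-Library.Function_Algebras"
    "HOL-Library.Complex_Order"
    "Jordan_Normal_Form.Matrix"
    "Graph_Theory.Digraph_Component"
begin

definition is_partition :: "nat \<Rightarrow> nat list \<Rightarrow> bool" where
  "is_partition n lam \<longleftrightarrow> sorted_wrt (\<ge>) lam \<and> 0 \<notin> set lam \<and> sum_list lam = n"

text \<open>
  The symmetric group of degree \<open>n\<close> consists of the \<open>p\<close> with \<open>p permutes {0..<n}\<close>.
  Elements of its complex group algebra are functions \<open>(nat \<Rightarrow> nat) \<Rightarrow> complex\<close>, the value
  at \<open>p\<close> being the coefficient of \<open>p\<close>.
\<close>

definition fscale :: "complex \<Rightarrow> ('a \<Rightarrow> complex) \<Rightarrow> 'a \<Rightarrow> complex" where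
  "fscale c f = (\<lambda>x. c * f x)"

interpretation fun_vs: vector_space fscale
  by unfold_locales (auto simp: fscale_def fun_eq_iff algebra_simps)

text \<open>
  Trace of a linear map \<open>T\<close> that leaves the finite-dimensional subspace \<open>V\<close> invariant.
\<close>

definition trace_on :: "('a \<Rightarrow> complex) set \<Rightarrow> (('a \<Rightarrow> complex) \<Rightarrow> ('a \<Rightarrow> complex)) \<Rightarrow> complex" where
  "trace_on V T =
     (let B = (SOME B. fun_vs.independent B \<and> fun_vs.span B = V)
      in \<Sum>b\<in>B. fun_vs.representation B (T b) b)"

text \<open>
  \<open>cell lam i\<close> is the (row, column) position of the entry \<open>i\<close> in the Young tableau of shape
  \<open>lam\<close> in which \<open>0, 1, 2, \<dots>\<close> are entered row by row.
\<close>

fun cell :: "nat list \<Rightarrow> nat \<Rightarrow> nat \<times> nat" where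
  "cell [] i = (0, i)"
| "cell (l # ls) i = (if i < l then (0, i) else apfst Suc (cell ls (i - l)))"

definition row_group :: "nat list \<Rightarrow> (nat \<Rightarrow> nat) set" where
  "row_group lam = {p. p permutes {0..<sum_list lam} \<and>
     (\<forall>i<sum_list lam. fst (cell lam (p i)) = fst (cell lam i))}"

definition column_group :: "nat list \<Rightarrow> (nat \<Rightarrow> nat) set" where
  "column_group lam = {q. q permutes {0..<sum_list lam} \<and>
     (\<forall>i<sum_list lam. snd (cell lam (q i)) = snd (cell lam i))}"

text \<open>
  The Young symmetrizer, that is the product in the group algebra of the sum of all \<open>p\<close> in the
  row group and the sum of all \<open>sign q \<cdot> q\<close> for \<open>q\<close> in the column group.
\<close>

definition young_symmetrizer :: "nat list \<Rightarrow> (nat \<Rightarrow> nat) \<Rightarrow> complex" where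
  "young_symmetrizer lam s =
     (\<Sum>(p, q) \<in> {(p, q) \<in> row_group lam \<times> column_group lam. p \<circ> q = s}. of_int (sign q))"

text \<open>
  The product \<open>g \<cdot> f\<close> in the group algebra: the coefficient of \<open>s\<close> in it is that of \<open>inv g \<circ> s\<close>
  in \<open>f\<close>.  (The notation \<open>inv\<close> is taken by HOL-Algebra here.)
\<close>

definition left_mult :: "(nat \<Rightarrow> nat) \<Rightarrow> ((nat \<Rightarrow> nat) \<Rightarrow> complex) \<Rightarrow> (nat \<Rightarrow> nat) \<Rightarrow> complex" where
  "left_mult g f = (\<lambda>s. f (inv_into UNIV g \<circ> s))"

text \<open>
  The Specht module: the left ideal of the group algebra generated by the Young symmetrizer.
\<close>

definition specht_module :: "nat list \<Rightarrow> ((nat \<Rightarrow> nat) \<Rightarrow> complex) set" where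
  "specht_module lam =
     fun_vs.span ((\<lambda>g. left_mult g (young_symmetrizer lam)) ` {g. g permutes {0..<sum_list lam}})"

text \<open>
  The character of the representation of the symmetric group on the Specht module.  With these conventions \<open>[n]\<close> yields the trivial and \<open>replicate n 1\<close> the sign character.
\<close>

definition sym_char :: "nat list \<Rightarrow> (nat \<Rightarrow> nat) \<Rightarrow> complex" where
  "sym_char lam g = trace_on (specht_module lam) (left_mult g)"

text \<open>Meant for square matrices whose dimension is \<open>sum_list lam\<close>.\<close>

definition immanant :: "nat list \<Rightarrow> complex mat \<Rightarrow> complex" where
  "immanant lam A =
     (\<Sum>p | p permutes {0..<dim_row A}. sym_char lam p * (\<Prod>i = 0..<dim_row A. A $$ (i, p i)))"

definition immanant_poly :: "nat list \<Rightarrow> complex mat \<Rightarrow> complex poly" where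
  "immanant_poly lam A =
     (THE P. \<forall>x. poly P x = immanant lam (x \<cdot>\<^sub>m 1\<^sub>m (dim_row A) - A))"

text \<open>
  The order on \<open>complex\<close> is the one of Complex_Order: \<open>z \<le> w\<close> iff \<open>w - z\<close> is a nonnegative real.
\<close>

definition immanant_coeff :: "nat list \<Rightarrow> nat \<Rightarrow> complex mat \<Rightarrow> complex" where
  "immanant_coeff lam r A = (-1) ^ r * coeff (immanant_poly lam A) (dim_row A - r)"

lemma immanant_poly_exists:
  assumes A: "A \<in> carrier_mat n n"
  shows "\<exists>P. degree P \<le> n \<and> (\<forall>x. poly P x = immanant lam (x \<cdot>\<^sub>m 1\<^sub>m n - A))"
proof -
  define e where "e = (\<lambda>p i. if p i = i then [:- (A $$ (i, i)), 1:] else [:- (A $$ (i, p i)):])"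
  define P where
    "P = (\<Sum>p | p permutes {0..<n}. Polynomial.smult (sym_char lam p) (\<Prod>i = 0..<n. e p i))"
  have "degree (\<Prod>i = 0..<n. e p i) \<le> n" for p
  proof -
    have "degree (\<Prod>i = 0..<n. e p i) \<le> (\<Sum>i = 0..<n. degree (e p i))"
      using degree_prod_sum_le[of "{0..<n}" "e p"] by (simp add: o_def)
    also have "\<dots> \<le> (\<Sum>i = 0..<n. 1)"
      by (rule sum_mono) (simp add: e_def)
    finally show ?thesis by simp
  qed
  then have "degree P \<le> n"
    unfolding P_def by (intro degree_sum_le) (auto intro: order_trans[OF degree_smult_le]
      simp: finite_permutations)
  moreover have "poly P x = immanant lam (x \<cdot>\<^sub>m 1\<^sub>m n - A)" for x
  proof -
    have "(\<Prod>i = 0..<n. poly (e p i) x) = (\<Prod>i = 0..<n. (x \<cdot>\<^sub>m 1\<^sub>m n - A) $$ (i, p i))"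
      if "p permutes {0..<n}" for p
      using A permutes_in_image[OF that] by (intro prod.cong) (auto simp: e_def)
    then show ?thesis
      using A by (simp add: P_def immanant_def poly_sum poly_prod)
  qed
  ultimately show ?thesis by blast
qed

lemma poly_immanant_poly_and_degree:
  assumes A: "A \<in> carrier_mat n n"
  shows "poly (immanant_poly lam A) x = immanant lam (x \<cdot>\<^sub>m 1\<^sub>m n - A)"
    and "degree (immanant_poly lam A) \<le> n"
proof -
  obtain P where P: "degree P \<le> n" "\<And>x. poly P x = immanant lam (x \<cdot>\<^sub>m 1\<^sub>m n - A)"
    using immanant_poly_exists[OF A] by blast
  have "immanant_poly lam A = P"
    unfolding immanant_poly_def using A P(2)
    by (intro the_equality) (auto simp: poly_eq_poly_eq_iff[symmetric] fun_eq_iff)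
  then show "poly (immanant_poly lam A) x = immanant lam (x \<cdot>\<^sub>m 1\<^sub>m n - A)"
    and "degree (immanant_poly lam A) \<le> n"
    using P by auto
qed

lemma immanant_eq_sum_immanant_coeff:
  assumes A: "A \<in> carrier_mat n n"
  shows "immanant lam (x \<cdot>\<^sub>m 1\<^sub>m n - A) =
    (\<Sum>r = 0..n. (-1) ^ r * immanant_coeff lam r A * x ^ (n - r))"
proof -
  have "immanant lam (x \<cdot>\<^sub>m 1\<^sub>m n - A) = poly (immanant_poly lam A) x"
    by (simp add: poly_immanant_poly_and_degree(1)[OF A])
  also have "\<dots> = (\<Sum>k\<le>n. coeff (immanant_poly lam A) k * x ^ k)"
    unfolding poly_altdef using poly_immanant_poly_and_degree(2)[OF A, of lam]
    by (intro sum.mono_neutral_left) (auto simp: coeff_eq_0)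
  also have "\<dots> = (\<Sum>r\<le>n. coeff (immanant_poly lam A) (n - r) * x ^ (n - r))"
    by (rule sum.reindex_bij_witness[of _ "\<lambda>r. n - r" "\<lambda>k. n - k"]) auto
  finally show ?thesis
    using A by (simp add: immanant_coeff_def atLeast0AtMost power_mult_distrib[symmetric]
        mult.assoc[symmetric])
qed

definition bipartite :: "('a, 'b) pre_digraph \<Rightarrow> bool" where
  "bipartite G \<longleftrightarrow> (\<exists>U W. verts G = U \<union> W \<and> U \<inter> W = {} \<and>
     (\<forall>u v. u \<rightarrow>\<^bsub>G\<^esub> v \<longrightarrow> u \<in> U \<and> v \<in> W \<or> u \<in> W \<and> v \<in> U))"

text \<open>
  The list \<open>vs\<close> enumerates the vertices of \<open>G\<close>.  In a graph every edge is represented by two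
  opposite arcs, so the degree of a vertex is its out-degree.
\<close>

definition degree_mat :: "('a, 'b) pre_digraph \<Rightarrow> 'a list \<Rightarrow> complex mat" where
  "degree_mat G vs = mat (length vs) (length vs)
     (\<lambda>(i, j). if i = j then of_nat (out_degree G (vs ! i)) else 0)"

definition adjacency_mat :: "('a, 'b) pre_digraph \<Rightarrow> 'a list \<Rightarrow> complex mat" where
  "adjacency_mat G vs = mat (length vs) (length vs)
     (\<lambda>(i, j). if vs ! i \<rightarrow>\<^bsub>G\<^esub> vs ! j then 1 else 0)"

definition laplacian :: "('a, 'b) pre_digraph \<Rightarrow> 'a list \<Rightarrow> complex mat" where
  "laplacian G vs = degree_mat G vs - adjacency_mat G vs"

end

theory Submission
  imports Defs "Jordan_Normal_Form.Determinant"
begin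

text \<open>
  Let \<open>a\<close> be the Laplacian and, for a set \<open>S\<close> of \<open>r\<close> vertices, let \<open>a\<^sub>S\<close> agree with \<open>a\<close> on
  \<open>S \<times> S\<close> and with the identity elsewhere. Multiplying out the diagonal products of \<open>x I - a\<close>
  shows that the coefficient attached to a character \<open>\<chi>\<close> is the sum over all such \<open>S\<close> of the
  immanants \<open>\<Sum>\<sigma>. \<chi> \<sigma> * \<Prod>i. a\<^sub>S i (\<sigma> i)\<close> (lemma \<open>immanant_coeff_eq_sum_padded\<close>). Both inequalities
  already hold for each \<open>S\<close>, and they have different reasons.

  Upper bound. In a bipartite graph, conjugation by the diagonal matrix with entry \<open>1\<close> on one colour
  class and \<open>-1\<close> on the other replaces every entry of the Laplacian by its absolute value and leaves
  all diagonal products alone, so these products are nonnegative (lemma \<open>prod_sign_balanced\<close>).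
  Hence \<open>Re (\<chi> \<sigma>) \<le> \<chi> id\<close> bounds the immanant, which is real, by \<open>\<chi> id\<close> times the permanent.

  Lower bound. This is the inequality of Schur: for a positive semidefinite matrix, \<open>\<chi> id\<close> times the
  determinant is at most the immanant (lemma \<open>schur_dominance\<close>). The matrices \<open>a\<^sub>S\<close> are Gram
  matrices because the Laplacian is the Gram matrix of the rows of an oriented incidence matrix.
  Gram-Schmidt turns this into a triangular factorization \<open>C C\<^sup>*\<close>. The immanant of \<open>C C\<^sup>*\<close>, expanded
  over all maps \<open>f\<close> of the index set into itself and averaged over the symmetric group, is a sum of
  one quadratic form in \<open>\<chi>\<close> for each \<open>f\<close>. All of them are nonnegative, and those with \<open>f\<close> a
  permutation contribute exactly \<open>\<chi> id\<close> times the determinant, as \<open>C\<close> is triangular.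

  About the irreducible character only three things are used: it is positive definite as a function
  on the group, its real part is largest at the identity, and it is positive there. The first two
  follow from \<open>\<chi> g = \<Sum>j. \<langle>g e\<^sub>j, e\<^sub>j\<rangle>\<close>, where the \<open>e\<^sub>j\<close> arise from generators of the Specht module by
  orthonormalization for an inner product invariant under the group (lemma \<open>sym_char_frame\<close>), the
  third from the fact that the Young symmetrizer is not zero. The one-row and the one-column shape
  give the trivial and the sign character, hence the permanent and the determinant.
\<close>

section \<open>Inner products and orthonormalization\<close>

definition inner_on :: "'x set \<Rightarrow> ('x \<Rightarrow> complex) \<Rightarrow> ('x \<Rightarrow> complex) \<Rightarrow> complex" where
  "inner_on X f g = (\<Sum>x\<in>X. f x * cnj (g x))"

lemma sum_fun_apply: "(\<Sum>a\<in>S. f a) x = (\<Sum>a\<in>S. f a x)"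
  by (induction S rule: infinite_finite_induct) auto

lemma inner_on_zero_right [simp]: "inner_on X f (\<lambda>x. 0) = 0"
  by (simp add: inner_on_def)

lemma inner_on_diff_left: "inner_on X (\<lambda>x. f x - g x) h = inner_on X f h - inner_on X g h"
  by (simp add: inner_on_def algebra_simps sum_subtractf)

lemma inner_on_scale_left: "inner_on X (\<lambda>x. c * f x) h = c * inner_on X f h"
  by (simp add: inner_on_def sum_distrib_left mult.assoc)

lemma inner_on_scale_right: "inner_on X f (\<lambda>x. c * h x) = cnj c * inner_on X f h"
  by (simp add: inner_on_def sum_distrib_left mult.left_commute)

lemma inner_on_sum_left: "inner_on X (\<lambda>x. \<Sum>a\<in>S. f a x) h = (\<Sum>a\<in>S. inner_on X (f a) h)"
  unfolding inner_on_def by (simp add: sum_distrib_right) (rule sum.swap)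

lemma inner_on_sum_right: "inner_on X f (\<lambda>x. \<Sum>a\<in>S. h a x) = (\<Sum>a\<in>S. inner_on X f (h a))"
  unfolding inner_on_def by (simp add: sum_distrib_left) (rule sum.swap)

lemma cnj_inner_on: "cnj (inner_on X f g) = inner_on X g f"
  by (simp add: inner_on_def mult.commute)

lemma inner_on_self: "inner_on X f f = of_real (\<Sum>x\<in>X. (cmod (f x))\<^sup>2)"
  unfolding inner_on_def of_real_sum complex_norm_square ..

lemma inner_on_self_nonneg: "0 \<le> inner_on X f f"
  unfolding inner_on_self by (simp add: less_eq_complex_def sum_nonneg)

lemma inner_on_self_eq_0_iff:
  assumes "finite X" and "\<And>x. x \<notin> X \<Longrightarrow> f x = 0"
  shows "inner_on X f f = 0 \<longleftrightarrow> f = (\<lambda>x. 0)"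
proof -
  have "inner_on X f f = 0 \<longleftrightarrow> (\<forall>x\<in>X. f x = 0)"
    unfolding inner_on_self of_real_eq_0_iff using assms(1) by (subst sum_nonneg_eq_0_iff) auto
  then show ?thesis
    using assms(2) by (auto simp: fun_eq_iff)
qed

text \<open>
  The vectors \<open>v i\<close> may be linearly dependent; a vector \<open>e j\<close> is then zero where orthonormalization
  has nothing left to normalize. Keeping these zeros makes the index of \<open>e\<close> match that of \<open>v\<close>,
  so that the coefficients form a square triangular matrix. The last two conjuncts (orthogonality
  and support) only serve to carry the induction.
\<close>

lemma gram_schmidt_exists:
  fixes v :: "nat \<Rightarrow> 'x \<Rightarrow> complex"
  assumes X: "finite X" and v: "\<forall>i<n. \<forall>x. x \<notin> X \<longrightarrow> v i x = 0"
  shows "\<exists>e. (\<forall>j<n. e j \<in> fun_vs.span (v ` {..<n})) \<and>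
    (\<forall>i<n. \<forall>x. v i x = (\<Sum>j<n. inner_on X (v i) (e j) * e j x)) \<and>
    (\<forall>j<n. \<forall>i<j. inner_on X (v i) (e j) = 0) \<and>
    (\<forall>i<n. \<forall>j<n. inner_on X (e i) (e j) = 0 \<or> i = j \<and> inner_on X (e i) (e i) = 1) \<and>
    (\<forall>j<n. \<forall>x. x \<notin> X \<longrightarrow> e j x = 0)"
  using v
proof (induction n)
  case 0
  show ?case by simp
next
  case (Suc n)
  have "\<forall>i<n. \<forall>x. x \<notin> X \<longrightarrow> v i x = 0"
    using Suc.prems by simp
  from Suc.IH[OF this] obtain e where
      e_span: "\<forall>j<n. e j \<in> fun_vs.span (v ` {..<n})"
    and v_expand: "\<forall>i<n. \<forall>x. v i x = (\<Sum>j<n. inner_on X (v i) (e j) * e j x)"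
    and triangular: "\<forall>j<n. \<forall>i<j. inner_on X (v i) (e j) = 0"
    and orth: "\<forall>i<n. \<forall>j<n. inner_on X (e i) (e j) = 0 \<or> i = j \<and> inner_on X (e i) (e i) = 1"
    and e_supp: "\<forall>j<n. \<forall>x. x \<notin> X \<longrightarrow> e j x = 0"
    by (elim exE conjE) (rule that; assumption)
  note e_span = e_span[rule_format] and v_expand = v_expand[rule_format]
    and triangular = triangular[rule_format] and orth = orth[rule_format]
    and e_supp = e_supp[rule_format]
  have orth_ne: "inner_on X (e i) (e j) = 0" if "i < n" "j < n" "i \<noteq> j" for i j
    using orth[OF that(1,2)] that(3) by blast
  define y where "y = (\<lambda>x. v n x - (\<Sum>j<n. inner_on X (v n) (e j) * e j x))"
  \<comment> \<open>the new vector is the normalized residual, or zero if \<open>v n\<close> is already in the span\<close>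
  define c where "c = (if y = (\<lambda>x. 0) then 0 else inverse (sqrt (Re (inner_on X y y))))"
  define e' where "e' = e(n := \<lambda>x. of_real c * y x)"
  have y_supp: "y x = 0" if "x \<notin> X" for x
    using that Suc.prems e_supp by (simp add: y_def)
  have norm_c: "of_real c * (of_real c * inner_on X y y) = (if y = (\<lambda>x. 0) then 0 else 1)"
  proof (cases "y = (\<lambda>x. 0)")
    case False
    define q where "q = (\<Sum>x\<in>X. (cmod (y x))\<^sup>2)"
    have q: "inner_on X y y = of_real q" "q \<ge> 0"
      by (simp_all add: q_def inner_on_self sum_nonneg)
    then have "q > 0"
      using False inner_on_self_eq_0_iff[OF X y_supp] by (cases "q = 0") auto
    then have "c * (c * q) = 1"
      using False q(1) by (simp add: c_def field_simps)
    then show ?thesis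
      using False q(1) by (metis of_real_1 of_real_mult)
  qed (simp add: c_def)
  have y_orth: "inner_on X y (e k) = 0" if k: "k < n" for k
  proof -
    have "(\<Sum>j<n. inner_on X (v n) (e j) * inner_on X (e j) (e k)) = inner_on X (v n) (e k) * inner_on X (e k) (e k)"
      using k orth_ne by (subst sum.remove[of _ k]) (auto intro!: sum.neutral)
    moreover have "inner_on X (v n) (e k) * inner_on X (e k) (e k) = inner_on X (v n) (e k)"
    proof (cases "inner_on X (e k) (e k) = 1")
      case False
      then have "e k = (\<lambda>x. 0)"
        using orth[OF k k] inner_on_self_eq_0_iff[of X "e k"] X e_supp[OF k] by blast
      then show ?thesis by simp
    qed simp
    ultimately show ?thesis
      by (simp add: y_def inner_on_diff_left inner_on_sum_left inner_on_scale_left)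
  qed
  have y_orth': "inner_on X (e k) y = 0" if "k < n" for k
    using y_orth[OF that] cnj_inner_on[of X y "e k"] by simp
  have vi_y: "inner_on X (v i) y = 0" if i: "i < n" for i
  proof -
    have "v i = (\<lambda>x. \<Sum>j<n. inner_on X (v i) (e j) * e j x)"
      by (rule ext) (rule v_expand[OF i])
    then have "inner_on X (v i) y = inner_on X (\<lambda>x. \<Sum>j<n. inner_on X (v i) (e j) * e j x) y"
      by (rule arg_cong)
    also have "\<dots> = (\<Sum>j<n. inner_on X (v i) (e j) * inner_on X (e j) y)"
      by (simp only: inner_on_sum_left inner_on_scale_left)
    finally have "inner_on X (v i) y = (\<Sum>j<n. inner_on X (v i) (e j) * inner_on X (e j) y)" .
    then show ?thesis using y_orth' by simp
  qed
  have vn_y: "inner_on X (v n) y = inner_on X y y"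
  proof -
    have "inner_on X y y = inner_on X (v n) y - (\<Sum>j<n. inner_on X (v n) (e j) * inner_on X (e j) y)"
      by (subst (1) y_def) (simp only: inner_on_diff_left inner_on_sum_left inner_on_scale_left)
    then show ?thesis using y_orth' by simp
  qed
  have span_mono: "fun_vs.span (v ` {..<n}) \<subseteq> fun_vs.span (v ` {..<Suc n})"
    by (rule fun_vs.span_mono) auto
  have "(\<lambda>x. of_real c * y x) = fscale c (v n - (\<Sum>j<n. fscale (inner_on X (v n) (e j)) (e j)))"
    by (simp add: fun_eq_iff y_def fscale_def sum_fun_apply)
  moreover have "\<dots> \<in> fun_vs.span (v ` {..<Suc n})"
    using e_span span_mono fun_vs.span_base[of "v n" "v ` {..<Suc n}"]
    by (intro fun_vs.span_scale fun_vs.span_diff fun_vs.span_sum) auto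
  ultimately have in_span: "e' j \<in> fun_vs.span (v ` {..<Suc n})" if "j < Suc n" for j
    using that e_span span_mono by (auto simp: e'_def less_Suc_eq)
  have expand: "v i x = (\<Sum>j<Suc n. inner_on X (v i) (e' j) * e' j x)" if "i < Suc n" for i x
  proof (cases "i = n")
    case True
    have "inner_on X (v n) (e' n) * e' n x = of_real c * (of_real c * inner_on X y y) * y x"
      by (simp add: e'_def inner_on_scale_right vn_y)
    then have "inner_on X (v n) (e' n) * e' n x = y x"
      using norm_c by (cases "y = (\<lambda>x. 0)") simp_all
    moreover have "v n x = (\<Sum>j<n. inner_on X (v n) (e j) * e j x) + y x"
      by (simp add: y_def)
    moreover have "e' j = e j" if "j < n" for j
      using that by (simp add: e'_def)
    ultimately show ?thesis using True by simp
  next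
    case False
    then have "i < n" using that by simp
    then have "inner_on X (v i) (e' n) = 0"
      using vi_y by (simp add: e'_def inner_on_scale_right)
    then show ?thesis using v_expand[OF \<open>i < n\<close>] by (simp add: e'_def)
  qed
  have tri: "inner_on X (v i) (e' j) = 0" if "j < Suc n" "i < j" for i j
    using that triangular vi_y by (auto simp: e'_def less_Suc_eq inner_on_scale_right)
  have orthn: "inner_on X (e' i) (e' j) = 0 \<or> i = j \<and> inner_on X (e' i) (e' i) = 1"
    if "i < Suc n" "j < Suc n" for i j
    using that orth y_orth y_orth' norm_c
    by (auto simp: e'_def less_Suc_eq inner_on_scale_right inner_on_scale_left split: if_splits)
  have supp: "e' j x = 0" if "j < Suc n" "x \<notin> X" for j x
    using that e_supp y_supp by (auto simp: e'_def less_Suc_eq)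
  show ?case
    by (intro exI[of _ e'] conjI allI impI) (rule in_span expand tri orthn supp; assumption)+
qed

lemma gram_schmidt:
  fixes v :: "nat \<Rightarrow> 'x \<Rightarrow> complex"
  assumes "finite X" and "\<forall>i<n. \<forall>x. x \<notin> X \<longrightarrow> v i x = 0"
  obtains e where "\<forall>j<n. e j \<in> fun_vs.span (v ` {..<n})"
    and "\<forall>i<n. v i = (\<Sum>j<n. fscale (inner_on X (v i) (e j)) (e j))"
    and "\<forall>j<n. \<forall>i<j. inner_on X (v i) (e j) = 0"
proof -
  from gram_schmidt_exists[OF assms] obtain e where
      e_span: "\<forall>j<n. e j \<in> fun_vs.span (v ` {..<n})"
    and expand: "\<forall>i<n. \<forall>x. v i x = (\<Sum>j<n. inner_on X (v i) (e j) * e j x)"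
    and triangular: "\<forall>j<n. \<forall>i<j. inner_on X (v i) (e j) = 0"
    by (elim exE conjE) (rule that; assumption)
  have "v i = (\<Sum>j<n. fscale (inner_on X (v i) (e j)) (e j))" if "i < n" for i
    by (rule ext) (simp add: sum_fun_apply fscale_def expand[rule_format, OF that, symmetric])
  then show thesis
    using that e_span triangular by blast
qed

section \<open>Traces\<close>

lemma fun_vs_finite_basis:
  assumes "finite S" and "fun_vs.independent B" and "fun_vs.span B = fun_vs.span S"
  shows "finite B"
  using fun_vs.independent_span_bound[OF assms(1,2)] assms(3) fun_vs.span_superset by auto

text \<open>
  The trace is defined through an arbitrarily chosen basis \<open>B\<close>. It agrees with \<open>\<Sum>j. \<langle>T e\<^sub>j, e\<^sub>j\<rangle>\<close> for
  every family \<open>e\<close> that reproduces the vectors of \<open>V\<close>: expand \<open>e\<^sub>j\<close> in \<open>B\<close>, exchange the two sums, and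
  the sum over \<open>j\<close> reassembles \<open>T b\<close>. Such a family may contain zero vectors, so the output of
  Gram-Schmidt can be used as it is.
\<close>

lemma trace_on_frame:
  fixes e :: "nat \<Rightarrow> 'x \<Rightarrow> complex"
  assumes S: "finite S" "V = fun_vs.span S"
    and T_scale: "\<And>c f. T (fscale c f) = fscale c (T f)"
    and T_add: "\<And>f g. T (f + g) = T f + T g"
    and T_in: "\<And>f. f \<in> V \<Longrightarrow> T f \<in> V"
    and e_in: "\<And>j. j < m \<Longrightarrow> e j \<in> V"
    and frame: "\<And>f. f \<in> V \<Longrightarrow> f = (\<Sum>j<m. fscale (inner_on X f (e j)) (e j))"
  shows "trace_on V T = (\<Sum>j<m. inner_on X (T (e j)) (e j))"
proof -
  define B where "B = (SOME B. fun_vs.independent B \<and> fun_vs.span B = V)"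
  have "\<exists>B. fun_vs.independent B \<and> fun_vs.span B = V"
    using fun_vs.maximal_independent_subset[of V]
    by (metis S(2) fun_vs.span_subspace fun_vs.subspace_span)
  then have B: "fun_vs.independent B" "fun_vs.span B = V"
    unfolding B_def by (rule someI2_ex, blast)+
  have fin: "finite B"
    using fun_vs_finite_basis[OF S(1) B(1)] B(2) S(2) by simp
  have T_zero: "T 0 = 0"
    using T_add[of 0 0] by simp
  have T_sum: "T (sum g A) = (\<Sum>a\<in>A. T (g a))" for g :: "('x \<Rightarrow> complex) \<Rightarrow> _" and A
    by (induction A rule: infinite_finite_induct)
      (simp_all only: sum.infinite sum.empty sum.insert T_add T_zero not_False_eq_True)
  let ?rep = "fun_vs.representation B"
  have inner_on_T: "inner_on X (T (e j)) h = (\<Sum>b\<in>B. ?rep (e j) b * inner_on X (T b) h)" if "j < m" for j h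
  proof -
    have "e j = (\<Sum>b\<in>B. fscale (?rep (e j) b) b)"
      using fun_vs.sum_representation_eq[OF B(1), of "e j" B] fin e_in[OF that] B(2) by simp
    then have "T (e j) = (\<Sum>b\<in>B. fscale (?rep (e j) b) (T b))"
      by (metis (no_types, lifting) T_sum T_scale sum.cong)
    also have "\<dots> = (\<lambda>x. \<Sum>b\<in>B. ?rep (e j) b * T b x)"
      by (simp add: fun_eq_iff sum_fun_apply fscale_def)
    finally show ?thesis by (simp add: inner_on_sum_left inner_on_scale_left)
  qed
  have "(\<Sum>j<m. inner_on X (T (e j)) (e j)) = (\<Sum>j<m. \<Sum>b\<in>B. ?rep (e j) b * inner_on X (T b) (e j))"
    by (rule sum.cong) (simp_all add: inner_on_T)
  also have "\<dots> = (\<Sum>b\<in>B. \<Sum>j<m. ?rep (e j) b * inner_on X (T b) (e j))"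
    by (rule sum.swap)
  also have "\<dots> = (\<Sum>b\<in>B. ?rep (T b) b)"
  proof (rule sum.cong[OF refl])
    fix b assume "b \<in> B"
    then have "T b \<in> V"
      using B(2) fun_vs.span_base T_in by blast
    then have "?rep (T b) b = ?rep (\<Sum>j<m. fscale (inner_on X (T b) (e j)) (e j)) b"
      using frame by metis
    also have "\<dots> = (\<Sum>j<m. ?rep (fscale (inner_on X (T b) (e j)) (e j)) b)"
      using e_in B by (subst fun_vs.representation_sum) (auto intro: fun_vs.span_scale)
    also have "\<dots> = (\<Sum>j<m. ?rep (e j) b * inner_on X (T b) (e j))"
      using e_in B by (intro sum.cong) (auto simp: fun_vs.representation_scale)
    finally show "(\<Sum>j<m. ?rep (e j) b * inner_on X (T b) (e j)) = ?rep (T b) b" by simp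
  qed
  finally show ?thesis
    by (simp add: trace_on_def B_def[symmetric])
qed

lemma trace_on_line:
  assumes f: "f \<noteq> 0" and T: "\<And>h. h \<in> fun_vs.span {f} \<Longrightarrow> T h = fscale c h"
  shows "trace_on (fun_vs.span {f}) T = c"
proof -
  define B where "B = (SOME B. fun_vs.independent B \<and> fun_vs.span B = fun_vs.span {f})"
  have "\<exists>B. fun_vs.independent B \<and> fun_vs.span B = fun_vs.span {f}"
    using f by (intro exI[of _ "{f}"]) (simp add: fun_vs.independent_insert)
  then have B: "fun_vs.independent B" "fun_vs.span B = fun_vs.span {f}"
    unfolding B_def by (rule someI2_ex, blast)+
  then have "card B = 1"
    using f fun_vs.dim_eq_card[OF B(2,1)] fun_vs.dim_eq_card_independent[of "{f}"]
    by (simp add: fun_vs.independent_insert)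
  then obtain b where b: "B = {b}"
    by (auto simp: card_Suc_eq)
  then have "b \<in> fun_vs.span {f}"
    using B(2) fun_vs.span_base[of b B] by simp
  moreover have "fun_vs.representation B (fscale c b) b = c"
    using B(1) b fun_vs.representation_basis[OF B(1), of b]
    by (subst fun_vs.representation_scale) (auto intro: fun_vs.span_base)
  ultimately show ?thesis
    using T by (simp add: trace_on_def B_def[symmetric] b)
qed

lemma trace_on_identity_pos:
  assumes S: "finite S" and f: "f \<in> fun_vs.span S" "f \<noteq> 0"
    and T: "\<And>h. T h = h"
  shows "0 < trace_on (fun_vs.span S) T"
proof -
  define B where "B = (SOME B. fun_vs.independent B \<and> fun_vs.span B = fun_vs.span S)"
  have "\<exists>B. fun_vs.independent B \<and> fun_vs.span B = fun_vs.span S"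
    using fun_vs.maximal_independent_subset[of "fun_vs.span S"]
    by (metis fun_vs.span_subspace fun_vs.subspace_span)
  then have B: "fun_vs.independent B" "fun_vs.span B = fun_vs.span S"
    unfolding B_def by (rule someI2_ex, blast)+
  have "finite B"
    using fun_vs_finite_basis[OF S B] .
  moreover have "B \<noteq> {}"
    using f B(2) by auto
  moreover have "trace_on (fun_vs.span S) T = (\<Sum>b\<in>B. 1)"
    using fun_vs.representation_basis[OF B(1)]
    by (simp add: trace_on_def B_def[symmetric] T)
  ultimately show ?thesis
    by (simp add: less_complex_def card_gt_0_iff)
qed

section \<open>Characters as positive definite functions\<close>

abbreviation perms :: "nat \<Rightarrow> (nat \<Rightarrow> nat) set" where
  "perms n \<equiv> {p. p permutes {0..<n}}"

abbreviation perm_inv :: "(nat \<Rightarrow> nat) \<Rightarrow> nat \<Rightarrow> nat" where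
  "perm_inv \<equiv> inv_into UNIV"

lemma finite_perms: "finite (perms n)"
  by (rule finite_permutations) simp

lemma frame_expansion:
  assumes "\<forall>i<m. v i = (\<Sum>j<m. fscale (inner_on X (v i) (e j)) (e j))"
    and "f \<in> fun_vs.span (v ` {..<m})"
  shows "f = (\<Sum>j<m. fscale (inner_on X f (e j)) (e j))"
proof -
  have "fun_vs.subspace {f. f = (\<Sum>j<m. fscale (inner_on X f (e j)) (e j))}"
  proof (rule fun_vs.subspaceI)
    show "0 \<in> {f. f = (\<Sum>j<m. fscale (inner_on X f (e j)) (e j))}"
      by (simp add: fun_eq_iff sum_fun_apply fscale_def inner_on_def)
  next
    fix f g
    assume "f \<in> {f. f = (\<Sum>j<m. fscale (inner_on X f (e j)) (e j))}"
      and "g \<in> {f. f = (\<Sum>j<m. fscale (inner_on X f (e j)) (e j))}"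
    then have "f + g = (\<Sum>j<m. fscale (inner_on X f (e j)) (e j) + fscale (inner_on X g (e j)) (e j))"
      by (simp only: sum.distrib mem_Collect_eq)
    also have "\<dots> = (\<Sum>j<m. fscale (inner_on X (f + g) (e j)) (e j))"
      by (simp add: fun_eq_iff sum_fun_apply fscale_def inner_on_def algebra_simps sum.distrib)
    finally show "f + g \<in> {f. f = (\<Sum>j<m. fscale (inner_on X f (e j)) (e j))}" by simp
  next
    fix c f
    assume "f \<in> {f. f = (\<Sum>j<m. fscale (inner_on X f (e j)) (e j))}"
    then have "fscale c f = fscale c (\<Sum>j<m. fscale (inner_on X f (e j)) (e j))"
      by (simp only: mem_Collect_eq)
    also have "\<dots> = (\<Sum>j<m. fscale (inner_on X (fscale c f) (e j)) (e j))"
      by (simp add: fun_eq_iff sum_fun_apply fscale_def inner_on_scale_left sum_distrib_left mult.assoc)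
    finally show "fscale c f \<in> {f. f = (\<Sum>j<m. fscale (inner_on X f (e j)) (e j))}" by simp
  qed
  then show ?thesis
    using fun_vs.span_minimal[of "v ` {..<m}" "{f. f = (\<Sum>j<m. fscale (inner_on X f (e j)) (e j))}"]
      assms by blast
qed

lemma left_mult_scale: "left_mult g (fscale c f) = fscale c (left_mult g f)"
  by (simp add: left_mult_def fscale_def)

lemma left_mult_add: "left_mult g (f + h) = left_mult g f + left_mult g h"
  by (simp add: left_mult_def fun_eq_iff)

lemma left_mult_id: "left_mult id f = f"
  by (simp add: left_mult_def)

lemma left_mult_comp:
  assumes "g permutes A" and "h permutes A"
  shows "left_mult (g \<circ> h) f = left_mult g (left_mult h f)"
  using assms by (simp add: left_mult_def o_inv_distrib permutes_bij comp_assoc)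

text \<open>
  Left multiplication permutes the coefficients, so it is unitary on the group algebra.
\<close>

lemma inner_on_left_mult:
  assumes "g permutes {0..<n}"
  shows "inner_on (perms n) (left_mult g f) (left_mult g h) = inner_on (perms n) f h"
  unfolding inner_on_def left_mult_def
  by (rule setum_permutations_compose_left[OF permutes_inv[OF assms], symmetric])

lemma inner_on_left_mult_shift:
  assumes g: "g permutes {0..<n}" and h: "h permutes {0..<n}"
  shows "inner_on (perms n) (left_mult (perm_inv g \<circ> h) f) f = inner_on (perms n) (left_mult h f) (left_mult g f)"
proof -
  have "left_mult h f = left_mult g (left_mult (perm_inv g \<circ> h) f)"
    using left_mult_comp[OF g permutes_compose[OF h permutes_inv[OF g]], of f] permutes_inv_o(1)[OF g]
    by (simp add: comp_assoc[symmetric])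
  then show ?thesis
    using inner_on_left_mult[OF g] by simp
qed

lemma left_mult_in_specht_module:
  assumes g: "g permutes {0..<sum_list lam}" and f: "f \<in> specht_module lam"
  shows "left_mult g f \<in> specht_module lam"
proof -
  let ?S = "(\<lambda>h. left_mult h (young_symmetrizer lam)) ` perms (sum_list lam)"
  have "fun_vs.subspace {f. left_mult g f \<in> fun_vs.span ?S}"
  proof (rule fun_vs.subspaceI)
    have "left_mult g 0 = 0"
      by (simp add: left_mult_def fun_eq_iff)
    then show "0 \<in> {f. left_mult g f \<in> fun_vs.span ?S}"
      using fun_vs.span_zero by (metis (mono_tags, lifting) mem_Collect_eq)
  qed (simp_all only: mem_Collect_eq left_mult_add left_mult_scale fun_vs.span_add fun_vs.span_scale)
  moreover have "?S \<subseteq> {f. left_mult g f \<in> fun_vs.span ?S}"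
    using g by (auto simp: left_mult_comp[symmetric] intro!: fun_vs.span_base permutes_compose)
  ultimately show ?thesis
    using f fun_vs.span_minimal unfolding specht_module_def by blast
qed

lemma young_symmetrizer_eq_0:
  assumes "\<not> s permutes {0..<sum_list lam}"
  shows "young_symmetrizer lam s = 0"
  using assms unfolding young_symmetrizer_def
  by (intro sum.neutral) (auto simp: row_group_def column_group_def intro: permutes_compose)

text \<open>
  Gram-Schmidt, applied to the finitely many translates of the Young symmetrizer, which span the
  Specht module, writes the character as a sum of diagonal matrix coefficients of a unitary
  representation.
\<close>

lemma sym_char_frame:
  obtains m :: nat and e where
    "\<And>g. g permutes {0..<sum_list lam} \<Longrightarrow>
       sym_char lam g = (\<Sum>j<m. inner_on (perms (sum_list lam)) (left_mult g (e j)) (e j))"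
proof -
  let ?n = "sum_list lam"
  let ?S = "(\<lambda>h. left_mult h (young_symmetrizer lam)) ` perms ?n"
  have fin: "finite ?S"
    using finite_perms by simp
  then obtain m v where v: "?S = v ` {..<m::nat}"
    using finite_conv_nat_seg_image[of ?S] by (auto simp: lessThan_def)
  have v_supp: "\<forall>i<m. \<forall>s. s \<notin> perms ?n \<longrightarrow> v i s = 0"
  proof (intro allI impI)
    fix i s assume that: "i < m" "s \<notin> perms ?n"
    have "v i \<in> ?S"
      using v that(1) by blast
    then obtain g where g: "g permutes {0..<?n}" "v i = left_mult g (young_symmetrizer lam)"
      by blast
    have "s = g \<circ> (perm_inv g \<circ> s)"
      using permutes_inv_o(1)[OF g(1)] by (simp add: comp_assoc[symmetric])
    then have "\<not> (perm_inv g \<circ> s) permutes {0..<?n}"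
      using that(2) g(1) permutes_compose by (metis mem_Collect_eq)
    then show "v i s = 0"
      by (simp add: g(2) left_mult_def young_symmetrizer_eq_0)
  qed
  obtain e where e_in: "\<forall>j<m. e j \<in> fun_vs.span (v ` {..<m})"
    and ve: "\<forall>i<m. v i = (\<Sum>j<m. fscale (inner_on (perms ?n) (v i) (e j)) (e j))"
    using gram_schmidt[OF finite_perms v_supp] .
  have V: "specht_module lam = fun_vs.span (v ` {..<m})"
    by (simp add: specht_module_def flip: v)
  have frame: "f = (\<Sum>j<m. fscale (inner_on (perms ?n) f (e j)) (e j))" if "f \<in> specht_module lam" for f
    using that unfolding V by (rule frame_expansion[OF ve])
  show thesis
  proof (rule that)
    fix g assume g: "g permutes {0..<?n}"
    show "sym_char lam g = (\<Sum>j<m. inner_on (perms ?n) (left_mult g (e j)) (e j))"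
      unfolding sym_char_def
      using fin V left_mult_in_specht_module[OF g] e_in frame
      by (intro trace_on_frame[where S = "v ` {..<m}"] left_mult_scale left_mult_add) auto
  qed
qed

text \<open>
  The usual notion of a positive definite function on a group. The order is that of the complex
  numbers, so the quadratic form is required to be real.
\<close>

definition positive_definite :: "nat \<Rightarrow> ((nat \<Rightarrow> nat) \<Rightarrow> complex) \<Rightarrow> bool" where
  "positive_definite n \<phi> \<longleftrightarrow>
     (\<forall>c. 0 \<le> (\<Sum>\<tau>\<in>perms n. \<Sum>\<pi>\<in>perms n. \<phi> (perm_inv \<pi> \<circ> \<tau>) * (c \<tau> * cnj (c \<pi>))))"

text \<open>
  Unitarity gives \<open>\<langle>\<pi>\<inverse> \<tau> e\<^sub>j, e\<^sub>j\<rangle> = \<langle>\<tau> e\<^sub>j, \<pi> e\<^sub>j\<rangle>\<close>, so the quadratic form is the sum over \<open>j\<close> of the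
  squared norms of \<open>\<Sum>\<tau>. c \<tau> \<cdot> \<tau> e\<^sub>j\<close>.
\<close>

lemma positive_definite_sym_char: "positive_definite (sum_list lam) (sym_char lam)"
  unfolding positive_definite_def
proof
  fix c :: "(nat \<Rightarrow> nat) \<Rightarrow> complex"
  let ?P = "perms (sum_list lam)"
  obtain m :: nat and e where chi: "\<And>g. g permutes {0..<sum_list lam} \<Longrightarrow>
       sym_char lam g = (\<Sum>j<m. inner_on ?P (left_mult g (e j)) (e j))"
    using sym_char_frame by blast
  have "(\<Sum>\<tau>\<in>?P. \<Sum>\<pi>\<in>?P. sym_char lam (perm_inv \<pi> \<circ> \<tau>) * (c \<tau> * cnj (c \<pi>))) =
      (\<Sum>\<tau>\<in>?P. \<Sum>\<pi>\<in>?P. \<Sum>j<m. inner_on ?P (left_mult \<tau> (e j)) (left_mult \<pi> (e j)) * (c \<tau> * cnj (c \<pi>)))"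
    by (intro sum.cong refl)
      (simp add: chi permutes_compose permutes_inv inner_on_left_mult_shift sum_distrib_right)
  also have "\<dots> = (\<Sum>\<tau>\<in>?P. \<Sum>j<m. \<Sum>\<pi>\<in>?P. inner_on ?P (left_mult \<tau> (e j)) (left_mult \<pi> (e j)) * (c \<tau> * cnj (c \<pi>)))"
    by (intro sum.cong refl) (rule sum.swap)
  also have "\<dots> = (\<Sum>j<m. \<Sum>\<tau>\<in>?P. \<Sum>\<pi>\<in>?P. inner_on ?P (left_mult \<tau> (e j)) (left_mult \<pi> (e j)) * (c \<tau> * cnj (c \<pi>)))"
    by (rule sum.swap)
  also have "\<dots> = (\<Sum>j<m. inner_on ?P (\<lambda>s. \<Sum>\<tau>\<in>?P. c \<tau> * left_mult \<tau> (e j) s) (\<lambda>s. \<Sum>\<tau>\<in>?P. c \<tau> * left_mult \<tau> (e j) s))"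
    by (simp add: inner_on_sum_left inner_on_sum_right inner_on_scale_left inner_on_scale_right sum_distrib_left mult_ac)
  also have "\<dots> \<ge> 0"
    by (intro sum_nonneg inner_on_self_nonneg)
  finally show "0 \<le> (\<Sum>\<tau>\<in>?P. \<Sum>\<pi>\<in>?P. sym_char lam (perm_inv \<pi> \<circ> \<tau>) * (c \<tau> * cnj (c \<pi>)))" .
qed

lemma Re_inner_on_le: "2 * Re (inner_on X f g) \<le> Re (inner_on X f f) + Re (inner_on X g g)"
proof -
  have "0 \<le> inner_on X (\<lambda>x. f x - g x) (\<lambda>x. f x - g x)"
    by (rule inner_on_self_nonneg)
  also have "\<dots> = inner_on X f f - inner_on X f g - inner_on X g f + inner_on X g g"
    by (simp add: inner_on_def algebra_simps sum_subtractf sum.distrib)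
  finally have "0 \<le> Re (inner_on X f f - inner_on X f g - inner_on X g f + inner_on X g g)"
    by (simp add: less_eq_complex_def)
  moreover have "Re (inner_on X g f) = Re (inner_on X f g)"
    by (simp flip: cnj_inner_on[of X f g])
  ultimately show ?thesis
    by simp
qed

text \<open>
  The vectors \<open>e\<^sub>j\<close> and \<open>g e\<^sub>j\<close> have the same norm, so \<open>Re \<langle>g e\<^sub>j, e\<^sub>j\<rangle> \<le> \<langle>e\<^sub>j, e\<^sub>j\<rangle>\<close>.
\<close>

lemma Re_sym_char_le:
  assumes "g permutes {0..<sum_list lam}"
  shows "Re (sym_char lam g) \<le> Re (sym_char lam id)"
proof -
  obtain m :: nat and e where chi: "\<And>g. g permutes {0..<sum_list lam} \<Longrightarrow>
       sym_char lam g = (\<Sum>j<m. inner_on (perms (sum_list lam)) (left_mult g (e j)) (e j))"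
    using sym_char_frame by blast
  have "Re (inner_on (perms (sum_list lam)) (left_mult g f) f) \<le> Re (inner_on (perms (sum_list lam)) f f)" for f
    using Re_inner_on_le[of "perms (sum_list lam)" "left_mult g f" f] inner_on_left_mult[OF assms] by simp
  then show ?thesis
    by (simp add: chi assms permutes_id left_mult_id sum_mono)
qed

lemma cell_inj:
  "cell lam i = cell lam j \<Longrightarrow> i < sum_list lam \<Longrightarrow> j < sum_list lam \<Longrightarrow> i = j"
proof (induction lam arbitrary: i j)
  case (Cons l ls)
  consider "i < l" "j < l" | "\<not> i < l" "\<not> j < l"
    using Cons.prems(1) by (cases "i < l"; cases "j < l") (auto simp: apfst_def map_prod_def split: prod.splits)
  then show ?case
  proof cases
    case 1
    then show ?thesis using Cons.prems(1) by simp
  next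
    case 2
    then have "cell ls (i - l) = cell ls (j - l)"
      using Cons.prems(1) by (simp add: prod_eq_iff)
    moreover have "i - l < sum_list ls" "j - l < sum_list ls"
      using 2 Cons.prems(2,3) by auto
    ultimately have "i - l = j - l"
      by (rule Cons.IH)
    then show ?thesis using 2 by simp
  qed
qed simp

text \<open>
  A permutation in both the row group and the column group fixes every cell, so the identity arises
  as a product \<open>p \<circ> q\<close> in one way only.
\<close>

lemma young_symmetrizer_id: "young_symmetrizer lam id = 1"
proof -
  have "p = id \<and> q = id" if p: "p \<in> row_group lam" and q: "q \<in> column_group lam" and pq: "p \<circ> q = id" for p q
  proof -
    have perm: "p permutes {0..<sum_list lam}" "q permutes {0..<sum_list lam}"
      using p q by (simp_all add: row_group_def column_group_def)
    have "q i = i" if i: "i < sum_list lam" for i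
    proof (rule cell_inj)
      show qi: "q i < sum_list lam"
        using permutes_in_image[OF perm(2), of i] i by simp
      have "fst (cell lam (p (q i))) = fst (cell lam (q i))"
        using p qi by (simp add: row_group_def)
      moreover have "p (q i) = i"
        using pq by (metis comp_apply id_apply)
      moreover have "snd (cell lam (q i)) = snd (cell lam i)"
        using q i by (simp add: column_group_def)
      ultimately show "cell lam (q i) = cell lam i"
        by (simp add: prod_eq_iff)
    qed (rule i)
    then have "q = id"
      using permutes_not_in[OF perm(2)] by (metis atLeastLessThan_iff eq_id_iff)
    then show ?thesis using pq by simp
  qed
  moreover have "id \<in> row_group lam" "id \<in> column_group lam"
    by (simp_all add: row_group_def column_group_def permutes_id)
  ultimately have "{(p, q) \<in> row_group lam \<times> column_group lam. p \<circ> q = id} = {(id, id)}"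
    by auto
  then show ?thesis
    by (simp add: young_symmetrizer_def)
qed

lemma sym_char_id_pos: "0 < sym_char lam id"
  unfolding sym_char_def specht_module_def
proof (rule trace_on_identity_pos)
  show "young_symmetrizer lam \<in> fun_vs.span ((\<lambda>g. left_mult g (young_symmetrizer lam)) ` perms (sum_list lam))"
    by (rule fun_vs.span_base) (metis (mono_tags, lifting) image_eqI left_mult_id mem_Collect_eq permutes_id)
  show "young_symmetrizer lam \<noteq> 0"
    using young_symmetrizer_id[of lam] by (metis zero_fun_apply zero_neq_one)
qed (simp_all add: finite_perms left_mult_id)

text \<open>
  If the group only rescales the Young symmetrizer, the Specht module is a line and its character
  is the scaling factor. This covers the shapes with one row or one column.
\<close>

lemma sym_char_of_eigenvector:
  assumes eigen: "\<And>g. g permutes {0..<sum_list lam} \<Longrightarrow>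
      left_mult g (young_symmetrizer lam) = fscale (c g) (young_symmetrizer lam)"
    and g: "g permutes {0..<sum_list lam}"
  shows "sym_char lam g = c g"
proof -
  let ?Y = "young_symmetrizer lam"
  let ?S = "(\<lambda>g. left_mult g ?Y) ` perms (sum_list lam)"
  have "?S \<subseteq> fun_vs.span {?Y}"
    using eigen by (auto intro: fun_vs.span_scale fun_vs.span_base)
  moreover have "?Y \<in> ?S"
    by (metis (mono_tags, lifting) image_eqI left_mult_id mem_Collect_eq permutes_id)
  ultimately have V: "specht_module lam = fun_vs.span {?Y}"
    unfolding specht_module_def
    by (intro subset_antisym fun_vs.span_minimal fun_vs.subspace_span) (auto intro: fun_vs.span_base)
  have "?Y \<noteq> 0"
    using young_symmetrizer_id[of lam] by (metis zero_fun_apply zero_neq_one)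
  then show ?thesis
    unfolding sym_char_def V
  proof (rule trace_on_line)
    fix h assume "h \<in> fun_vs.span {?Y}"
    then obtain k where "h = fscale k ?Y"
      by (auto simp: fun_vs.span_singleton)
    then show "left_mult g h = fscale (c g) h"
      by (simp add: left_mult_scale eigen[OF g])
  qed
qed

section \<open>The trivial and the sign character\<close>

lemma young_symmetrizer_row:
  "young_symmetrizer [n] s = (if s permutes {0..<n} then 1 else 0)"
proof -
  have "row_group [n] = perms n"
    by (auto simp: row_group_def permutes_in_image dest: permutes_in_image)
  moreover have "column_group [n] = {id}"
  proof -
    have "q = id" if "q permutes {0..<n}" "\<forall>i<n. snd (cell [n] (q i)) = snd (cell [n] i)" for q
    proof
      fix i
      show "q i = id i"
        using that permutes_in_image[OF that(1), of i] permutes_not_in[OF that(1), of i]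
        by (cases "i < n") auto
    qed
    then show ?thesis
      by (auto simp: column_group_def permutes_id)
  qed
  ultimately have "{(p, q) \<in> row_group [n] \<times> column_group [n]. p \<circ> q = s} =
      (if s permutes {0..<n} then {(s, id)} else {})"
    by auto
  then show ?thesis
    by (simp add: young_symmetrizer_def)
qed

lemma cell_replicate_1: "i < n \<Longrightarrow> cell (replicate n 1) i = (i, 0)"
  by (induction n arbitrary: i) auto

lemma young_symmetrizer_column:
  "young_symmetrizer (replicate n 1) s = (if s permutes {0..<n} then of_int (sign s) else 0)"
proof -
  have image: "p i < n" if "p permutes {0..<n}" "i < n" for p i
    using that permutes_in_image[of p "{0..<n}" i] by simp
  have n: "sum_list (replicate n 1) = n"
    by (simp add: sum_list_replicate)
  have "column_group (replicate n 1) = perms n"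
    by (auto simp: column_group_def n cell_replicate_1 image simp del: One_nat_def)
  moreover have "row_group (replicate n 1) = {id}"
  proof -
    have "q = id" if q: "q permutes {0..<n}"
      "\<forall>i<n. fst (cell (replicate n 1) (q i)) = fst (cell (replicate n 1) i)" for q
    proof
      fix i
      show "q i = id i"
        using q(2) image[OF q(1), of i] permutes_not_in[OF q(1), of i]
        by (cases "i < n") (auto simp: cell_replicate_1 simp del: One_nat_def)
    qed
    then show ?thesis
      by (auto simp: row_group_def n permutes_id simp del: One_nat_def)
  qed
  ultimately have "{(p, q) \<in> row_group (replicate n 1) \<times> column_group (replicate n 1). p \<circ> q = s} =
      (if s permutes {0..<n} then {(id, s)} else {})"
    by auto
  then show ?thesis
    by (simp add: young_symmetrizer_def del: One_nat_def)
qed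

lemma permutes_inv_comp_iff:
  assumes "g permutes A"
  shows "(perm_inv g \<circ> s) permutes A \<longleftrightarrow> s permutes A"
proof
  assume "(perm_inv g \<circ> s) permutes A"
  then have "(g \<circ> (perm_inv g \<circ> s)) permutes A"
    using assms by (rule permutes_compose)
  then show "s permutes A"
    using permutes_inv_o(1)[OF assms] by (simp add: comp_assoc[symmetric])
qed (simp add: assms permutes_compose permutes_inv)

lemma sym_char_row:
  assumes "g permutes {0..<n}"
  shows "sym_char [n] g = 1"
  by (rule sym_char_of_eigenvector[where c = "\<lambda>_. 1"])
    (use assms in \<open>simp_all add: fun_eq_iff left_mult_def young_symmetrizer_row fscale_def
      permutes_inv_comp_iff del: o_apply\<close>)

lemma sym_char_column:
  assumes "g permutes {0..<n}"
  shows "sym_char (replicate n 1) g = of_int (sign g)"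
proof (rule sym_char_of_eigenvector[where c = "\<lambda>g. of_int (sign g)"])
  fix h :: "nat \<Rightarrow> nat"
  assume "h permutes {0..<sum_list (replicate n 1)}"
  then have h: "h permutes {0..<n}"
    by (simp add: sum_list_replicate)
  have "sign (perm_inv h \<circ> s) = sign h * sign s" if "s permutes {0..<n}" for s
    using h that by (metis finite_atLeastLessThan permutation_permutes permutes_inv sign_compose sign_inverse)
  then show "left_mult h (young_symmetrizer (replicate n 1)) =
      fscale (of_int (sign h)) (young_symmetrizer (replicate n 1))"
    by (simp add: fun_eq_iff left_mult_def young_symmetrizer_column fscale_def
      permutes_inv_comp_iff[OF h] del: One_nat_def)
qed (use assms in \<open>simp add: sum_list_replicate\<close>)

section \<open>Schur's dominance of the determinant\<close>

lemma prod_permuted_gram: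
  fixes C :: "nat \<Rightarrow> nat \<Rightarrow> complex"
  assumes A: "\<forall>i<n. \<forall>j<n. A i j = (\<Sum>k\<in>{0..<n}. C i k * cnj (C j k))"
    and \<sigma>: "\<sigma> permutes {0..<n}"
  shows "(\<Prod>i = 0..<n. A i (\<sigma> i)) = (\<Sum>f\<in>{0..<n} \<rightarrow>\<^sub>E {0..<n}.
    (\<Prod>i = 0..<n. C i (f i)) * cnj (\<Prod>i = 0..<n. C i (f (perm_inv \<sigma> i))))"
proof -
  have "\<sigma> i < n" if "i < n" for i
    using permutes_in_image[OF \<sigma>, of i] that by simp
  then have "(\<Prod>i = 0..<n. A i (\<sigma> i)) = (\<Prod>i = 0..<n. \<Sum>k\<in>{0..<n}. C i k * cnj (C (\<sigma> i) k))"
    by (intro prod.cong) (auto simp: A)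
  also have "\<dots> = (\<Sum>f\<in>{0..<n} \<rightarrow>\<^sub>E {0..<n}. \<Prod>i = 0..<n. C i (f i) * cnj (C (\<sigma> i) (f i)))"
    by (rule prod_sum_PiE) auto
  also have "\<dots> = (\<Sum>f\<in>{0..<n} \<rightarrow>\<^sub>E {0..<n}.
      (\<Prod>i = 0..<n. C i (f i)) * cnj (\<Prod>i = 0..<n. C i (f (perm_inv \<sigma> i))))"
  proof (rule sum.cong[OF refl])
    fix f
    have "(\<Prod>i = 0..<n. C i (f (perm_inv \<sigma> i))) = (\<Prod>i = 0..<n. C (\<sigma> i) (f i))"
      using prod.permute[OF \<sigma>, of "\<lambda>i. C i (f (perm_inv \<sigma> i))"] permutes_inverses(2)[OF \<sigma>]
      by (simp add: o_def)
    then show "(\<Prod>i = 0..<n. C i (f i) * cnj (C (\<sigma> i) (f i))) =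
        (\<Prod>i = 0..<n. C i (f i)) * cnj (\<Prod>i = 0..<n. C i (f (perm_inv \<sigma> i)))"
      by (simp add: prod.distrib)
  qed
  finally show ?thesis .
qed

lemma sum_PiE_permute:
  fixes \<tau> :: "nat \<Rightarrow> nat"
  assumes \<tau>: "\<tau> permutes A"
  shows "sum h (A \<rightarrow>\<^sub>E B) = (\<Sum>f\<in>A \<rightarrow>\<^sub>E B. h (f \<circ> \<tau>))"
proof -
  have shift: "f \<circ> \<pi> \<in> A \<rightarrow>\<^sub>E B" if "f \<in> A \<rightarrow>\<^sub>E B" "\<pi> permutes A" for f \<pi>
    using that permutes_in_image[OF that(2)] by (auto simp: PiE_def extensional_def)
  show ?thesis
    using permutes_inv_o[OF \<tau>] shift[OF _ \<tau>] shift[OF _ permutes_inv[OF \<tau>]]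
    by (intro sum.reindex_bij_witness[where i = "\<lambda>f. f \<circ> \<tau>" and j = "\<lambda>f. f \<circ> perm_inv \<tau>"])
      (auto simp: comp_assoc)
qed

lemma sum_perms_quotient:
  assumes \<tau>: "\<tau> permutes {0..<n}"
  shows "(\<Sum>\<sigma>\<in>perms n. h \<sigma> (\<tau> \<circ> perm_inv \<sigma>)) = (\<Sum>\<pi>\<in>perms n. h (perm_inv \<pi> \<circ> \<tau>) \<pi>)"
proof (rule sum.reindex_bij_witness[where j = "\<lambda>\<sigma>. \<tau> \<circ> perm_inv \<sigma>" and i = "\<lambda>\<pi>. perm_inv \<pi> \<circ> \<tau>"])
  have key: "perm_inv (\<alpha> \<circ> \<beta>) = perm_inv \<beta> \<circ> perm_inv \<alpha>"
    if "\<alpha> permutes {0..<n}" "\<beta> permutes {0..<n}" for \<alpha> \<beta>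
    using that by (simp add: o_inv_distrib permutes_bij)
  fix \<sigma> assume "\<sigma> \<in> perms n"
  then have \<sigma>: "\<sigma> permutes {0..<n}" by simp
  have cancel: "perm_inv (\<tau> \<circ> perm_inv \<sigma>) \<circ> \<tau> = \<sigma>"
    using key[OF \<tau> permutes_inv[OF \<sigma>]] permutes_inv_o[OF \<tau>] permutes_inv_inv[OF \<sigma>]
    by (simp add: comp_assoc)
  then show "perm_inv (\<tau> \<circ> perm_inv \<sigma>) \<circ> \<tau> = \<sigma>" .
  show "\<tau> \<circ> perm_inv \<sigma> \<in> perms n" "perm_inv \<sigma> \<circ> \<tau> \<in> perms n"
    using \<sigma> \<tau> by (simp_all add: permutes_compose permutes_inv)
  show "\<tau> \<circ> perm_inv (perm_inv \<sigma> \<circ> \<tau>) = \<sigma>"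
    using key[OF permutes_inv[OF \<sigma>] \<tau>] permutes_inv_o[OF \<tau>] permutes_inv_inv[OF \<sigma>]
    by (simp add: comp_assoc[symmetric])
  show "h (perm_inv (\<tau> \<circ> perm_inv \<sigma>) \<circ> \<tau>) (\<tau> \<circ> perm_inv \<sigma>) = h \<sigma> (\<tau> \<circ> perm_inv \<sigma>)"
    by (simp only: cancel)
qed

text \<open>
  Write \<open>w f = \<Prod>i. C i (f i)\<close>. The diagonal product for \<open>\<sigma>\<close> is the sum of \<open>w f * cnj (w (f \<circ> \<sigma>\<inverse>))\<close> over all
  maps \<open>f\<close>. Replacing \<open>f\<close> by \<open>f \<circ> \<tau>\<close> and summing over \<open>\<tau>\<close> as well turns \<open>n!\<close> times the immanant into a sum
  of the values \<open>Q f\<close> of the quadratic form of \<open>\<phi>\<close> at \<open>\<tau> \<mapsto> w (f \<circ> \<tau>)\<close>, all nonnegative. Since \<open>C\<close> is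
  triangular, \<open>w p\<close> vanishes for every permutation \<open>p\<close> but the identity; hence \<open>Q p\<close> is
  \<open>\<phi> id\<close> times the squared modulus of \<open>w id\<close> for each of the \<open>n!\<close> permutations \<open>p\<close>, and dropping
  the other maps gives the bound.
\<close>

lemma schur_triangular:
  fixes C :: "nat \<Rightarrow> nat \<Rightarrow> complex"
  assumes pd: "positive_definite n \<phi>"
    and A: "\<forall>i<n. \<forall>j<n. A i j = (\<Sum>k\<in>{0..<n}. C i k * cnj (C j k))"
    and triangular: "\<forall>k<n. \<forall>i<k. C i k = 0"
  shows "\<phi> id * ((\<Prod>i = 0..<n. C i i) * cnj (\<Prod>i = 0..<n. C i i))
    \<le> (\<Sum>\<sigma>\<in>perms n. \<phi> \<sigma> * (\<Prod>i = 0..<n. A i (\<sigma> i)))" (is "_ \<le> ?imm")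
proof -
  define F where "F = {0..<n} \<rightarrow>\<^sub>E {0..<n}"
  define w where "w f = (\<Prod>i = 0..<n. C i (f i))" for f
  define Q where "Q f = (\<Sum>\<tau>\<in>perms n. \<Sum>\<pi>\<in>perms n.
      \<phi> (perm_inv \<pi> \<circ> \<tau>) * (w (f \<circ> \<tau>) * cnj (w (f \<circ> \<pi>))))" for f
  have F: "finite F"
    unfolding F_def by (rule finite_PiE) auto
  have Q_nonneg: "0 \<le> Q f" for f
    using pd unfolding positive_definite_def Q_def by (rule allE[of _ "\<lambda>\<tau>. w (f \<circ> \<tau>)"])
  \<comment> \<open>shift the maps by \<open>\<tau>\<close>, then substitute \<open>\<pi> = \<tau> \<circ> \<sigma>\<inverse>\<close>\<close>
  have imm: "?imm = (\<Sum>\<pi>\<in>perms n. \<Sum>f\<in>F. \<phi> (perm_inv \<pi> \<circ> \<tau>) * (w (f \<circ> \<tau>) * cnj (w (f \<circ> \<pi>))))"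
    if \<tau>: "\<tau> permutes {0..<n}" for \<tau>
  proof -
    have "?imm = (\<Sum>\<sigma>\<in>perms n. \<Sum>f\<in>F. \<phi> \<sigma> * (w f * cnj (w (f \<circ> perm_inv \<sigma>))))"
      by (intro sum.cong refl) (simp add: prod_permuted_gram[where C = C, OF A] F_def w_def sum_distrib_left)
    also have "\<dots> = (\<Sum>\<sigma>\<in>perms n. \<Sum>f\<in>F. \<phi> \<sigma> * (w (f \<circ> \<tau>) * cnj (w (f \<circ> (\<tau> \<circ> perm_inv \<sigma>)))))"
      unfolding F_def by (subst sum_PiE_permute[OF \<tau>]) (simp only: comp_assoc)
    also have "\<dots> = (\<Sum>\<pi>\<in>perms n. \<Sum>f\<in>F. \<phi> (perm_inv \<pi> \<circ> \<tau>) * (w (f \<circ> \<tau>) * cnj (w (f \<circ> \<pi>))))"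
      by (rule sum_perms_quotient[OF \<tau>,
            where h = "\<lambda>\<sigma> \<pi>. \<Sum>f\<in>F. \<phi> \<sigma> * (w (f \<circ> \<tau>) * cnj (w (f \<circ> \<pi>)))"])
    finally show ?thesis .
  qed
  have "of_nat (card (perms n)) * ?imm = (\<Sum>\<tau>\<in>perms n. ?imm)"
    by simp
  also have "\<dots> = (\<Sum>\<tau>\<in>perms n. \<Sum>\<pi>\<in>perms n. \<Sum>f\<in>F. \<phi> (perm_inv \<pi> \<circ> \<tau>) * (w (f \<circ> \<tau>) * cnj (w (f \<circ> \<pi>))))"
    by (rule sum.cong[OF refl]) (rule imm, simp)
  also have "\<dots> = (\<Sum>\<tau>\<in>perms n. \<Sum>f\<in>F. \<Sum>\<pi>\<in>perms n. \<phi> (perm_inv \<pi> \<circ> \<tau>) * (w (f \<circ> \<tau>) * cnj (w (f \<circ> \<pi>))))"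
    by (rule sum.cong[OF refl]) (rule sum.swap)
  also have "\<dots> = (\<Sum>f\<in>F. Q f)"
    unfolding Q_def by (rule sum.swap)
  finally have total: "of_nat (card (perms n)) * ?imm = (\<Sum>f\<in>F. Q f)" .
  have w_perm: "w p = (if p = id then w id else 0)" if p: "p permutes {0..<n}" for p
  proof (cases "\<forall>i\<in>{0..<n}. p i \<le> i")
    case True
    then have "p = id"
      by (rule permutes_natset_le[OF p])
    then show ?thesis by simp
  next
    case False
    then obtain i where i: "i < n" "i < p i"
      by (auto simp: not_le)
    then have "C i (p i) = 0"
      using permutes_in_image[OF p, of i] by (intro triangular[rule_format]) simp_all
    then have "w p = 0"
      unfolding w_def using i by (intro prod_zero) auto
    then show ?thesis
      using i by auto
  qed
  have Q_perm: "Q (restrict p {0..<n}) = \<phi> id * (w id * cnj (w id))" if p: "p permutes {0..<n}" for p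
  proof -
    have w_res: "w (restrict p {0..<n} \<circ> \<tau>) = (if \<tau> = perm_inv p then w id else 0)"
      if \<tau>: "\<tau> permutes {0..<n}" for \<tau>
    proof -
      have "w (restrict p {0..<n} \<circ> \<tau>) = w (p \<circ> \<tau>)"
        unfolding w_def using permutes_in_image[OF \<tau>] by (intro prod.cong) auto
      moreover have "p \<circ> \<tau> = id \<longleftrightarrow> \<tau> = perm_inv p"
        using permutes_inv_o[OF p] by (metis comp_assoc comp_id id_comp)
      ultimately show ?thesis
        using w_perm[OF permutes_compose[OF \<tau> p]] by simp
    qed
    have "Q (restrict p {0..<n}) = (\<Sum>\<tau>\<in>perms n. \<Sum>\<pi>\<in>perms n.
        if \<pi> = perm_inv p then if \<tau> = perm_inv p then \<phi> (perm_inv \<pi> \<circ> \<tau>) * (w id * cnj (w id)) else 0 else 0)"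
      unfolding Q_def by (intro sum.cong refl) (simp add: w_res)
    also have "\<dots> = \<phi> (perm_inv (perm_inv p) \<circ> perm_inv p) * (w id * cnj (w id))"
      using permutes_inv[OF p] finite_perms by (simp add: sum.delta)
    also have "perm_inv (perm_inv p) \<circ> perm_inv p = id"
      by (rule permutes_inv_o(2)[OF permutes_inv[OF p]])
    finally show ?thesis .
  qed
  have inj: "inj_on (\<lambda>p. restrict p {0..<n}) (perms n)"
  proof (rule inj_onI)
    fix p q assume pq: "p \<in> perms n" "q \<in> perms n" "restrict p {0..<n} = restrict q {0..<n}"
    show "p = q"
    proof
      fix i
      show "p i = q i"
        using pq permutes_not_in[of p "{0..<n}" i] permutes_not_in[of q "{0..<n}" i]
        by (cases "i \<in> {0..<n}") (auto dest: fun_cong[of _ _ i])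
    qed
  qed
  have "of_nat (card (perms n)) * (\<phi> id * (w id * cnj (w id))) = (\<Sum>p\<in>perms n. Q (restrict p {0..<n}))"
    by (simp add: Q_perm)
  also have "\<dots> = (\<Sum>f\<in>(\<lambda>p. restrict p {0..<n}) ` perms n. Q f)"
    by (simp add: sum.reindex[OF inj])
  also have "\<dots> \<le> (\<Sum>f\<in>F. Q f)"
  proof (rule sum_mono2[OF F])
    show "(\<lambda>p. restrict p {0..<n}) ` perms n \<subseteq> F"
      unfolding F_def using permutes_in_image by (fastforce simp: restrict_def)
  qed (rule Q_nonneg)
  finally have "of_nat (card (perms n)) * (\<phi> id * (w id * cnj (w id))) \<le> of_nat (card (perms n)) * ?imm"
    by (simp only: total)
  moreover have "card (perms n) > 0"
    by (simp add: card_permutations[OF refl])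
  ultimately have "\<phi> id * (w id * cnj (w id)) \<le> ?imm"
    by (simp add: less_eq_complex_def)
  then show ?thesis
    by (simp add: w_def)
qed

lemma sum_sign_triangular:
  fixes C :: "nat \<Rightarrow> nat \<Rightarrow> complex"
  assumes A: "\<forall>i<n. \<forall>j<n. A i j = (\<Sum>k\<in>{0..<n}. C i k * cnj (C j k))"
    and triangular: "\<forall>k<n. \<forall>i<k. C i k = 0"
  shows "(\<Sum>\<sigma>\<in>perms n. of_int (sign \<sigma>) * (\<Prod>i = 0..<n. A i (\<sigma> i))) =
    (\<Prod>i = 0..<n. C i i) * cnj (\<Prod>i = 0..<n. C i i)"
proof -
  let ?A = "mat n n (\<lambda>(i, j). A i j)"
  let ?L = "mat n n (\<lambda>(i, k). C i k)"
  let ?U = "mat n n (\<lambda>(k, j). cnj (C j k))"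
  have "(\<Sum>\<sigma>\<in>perms n. of_int (sign \<sigma>) * (\<Prod>i = 0..<n. A i (\<sigma> i))) = Determinant.det ?A"
    by (subst det_def'[of _ n]) (auto intro!: sum.cong prod.cong simp: permutes_in_image)
  also have "?A = ?L * ?U"
    by (rule eq_matI) (auto simp: A scalar_prod_def)
  also have "Determinant.det (?L * ?U) = Determinant.det ?L * Determinant.det ?U"
    by (rule det_mult[of _ n]) auto
  also have "Determinant.det ?L = (\<Prod>i = 0..<n. C i i)"
    by (subst det_lower_triangular[of n]) (auto simp: triangular prod_list_diag_prod)
  also have "Determinant.det ?U = cnj (\<Prod>i = 0..<n. C i i)"
    by (subst det_upper_triangular[of _ n]) (auto simp: triangular prod_list_diag_prod)
  finally show ?thesis .
qed

text \<open>
  Schur's inequality. The scalar products \<open>\<langle>v i, e k\<rangle>\<close> with the Gram-Schmidt vectors are the entries of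
  a triangular factor of the Gram matrix, to which \<open>schur_triangular\<close> applies; the same factor
  evaluates the determinant.
\<close>

lemma schur_dominance:
  assumes pd: "positive_definite n \<phi>"
    and X: "finite X" and v: "\<forall>i<n. \<forall>x. x \<notin> X \<longrightarrow> v i x = 0"
    and A: "\<forall>i<n. \<forall>j<n. A i j = inner_on X (v i) (v j)"
  shows "\<phi> id * (\<Sum>\<sigma>\<in>perms n. of_int (sign \<sigma>) * (\<Prod>i = 0..<n. A i (\<sigma> i)))
    \<le> (\<Sum>\<sigma>\<in>perms n. \<phi> \<sigma> * (\<Prod>i = 0..<n. A i (\<sigma> i)))"
proof -
  obtain e where expand: "\<forall>i<n. v i = (\<Sum>j<n. fscale (inner_on X (v i) (e j)) (e j))"
    and triangular: "\<forall>j<n. \<forall>i<j. inner_on X (v i) (e j) = 0"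
    using gram_schmidt[OF X v] .
  have gram: "\<forall>i<n. \<forall>j<n. A i j = (\<Sum>k\<in>{0..<n}. inner_on X (v i) (e k) * cnj (inner_on X (v j) (e k)))"
  proof (intro allI impI)
    fix i j assume that: "i < n" "j < n"
    have "inner_on X (v i) (v j) = inner_on X (\<Sum>k<n. fscale (inner_on X (v i) (e k)) (e k)) (v j)"
      by (rule arg_cong[OF expand[rule_format, OF \<open>i < n\<close>]])
    also have "(\<Sum>k<n. fscale (inner_on X (v i) (e k)) (e k)) = (\<lambda>x. \<Sum>k<n. inner_on X (v i) (e k) * e k x)"
      by (simp add: fun_eq_iff sum_fun_apply fscale_def)
    also have "inner_on X \<dots> (v j) = (\<Sum>k<n. inner_on X (v i) (e k) * cnj (inner_on X (v j) (e k)))"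
      by (simp add: inner_on_sum_left inner_on_scale_left cnj_inner_on)
    finally show "A i j = (\<Sum>k\<in>{0..<n}. inner_on X (v i) (e k) * cnj (inner_on X (v j) (e k)))"
      using A that by (simp add: atLeast0LessThan)
  qed
  show ?thesis
    using schur_triangular[OF pd gram triangular] sum_sign_triangular[OF gram triangular] by simp
qed

section \<open>Immanant coefficients as sums over principal submatrices\<close>

definition pad_identity :: "nat set \<Rightarrow> (nat \<Rightarrow> nat \<Rightarrow> complex) \<Rightarrow> nat \<Rightarrow> nat \<Rightarrow> complex" where
  "pad_identity S a i j = (if i \<in> S \<and> j \<in> S then a i j else if i = j then 1 else 0)"

text \<open>
  The left-hand side is the term of \<open>\<Prod>i. (x I - a) i (\<sigma> i)\<close> that takes \<open>- a\<close> in the rows of \<open>S\<close> and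
  \<open>x I\<close> in the others. If \<open>\<sigma>\<close> moves a point outside \<open>S\<close>, both sides vanish; otherwise \<open>\<sigma>\<close>
  maps \<open>S\<close> to itself.
\<close>

lemma prod_characteristic_term:
  fixes a :: "nat \<Rightarrow> nat \<Rightarrow> complex"
  assumes \<sigma>: "\<sigma> permutes {0..<n}" and S: "S \<subseteq> {0..<n}"
  shows "(\<Prod>i\<in>S. - a i (\<sigma> i)) * (\<Prod>i\<in>{0..<n} - S. if i = \<sigma> i then x else 0) =
    (-1) ^ card S * x ^ (n - card S) * (\<Prod>i = 0..<n. pad_identity S a i (\<sigma> i))"
proof -
  have split: "(\<Prod>i = 0..<n. pad_identity S a i (\<sigma> i)) =
      (\<Prod>i\<in>S. pad_identity S a i (\<sigma> i)) * (\<Prod>i\<in>{0..<n} - S. pad_identity S a i (\<sigma> i))"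
    using prod.subset_diff[OF S, of "\<lambda>i. pad_identity S a i (\<sigma> i)"] by (simp add: mult.commute)
  show ?thesis
  proof (cases "\<forall>i\<in>{0..<n} - S. i = \<sigma> i")
    case True
    have "\<sigma> i \<in> S" if "i \<in> S" for i
    proof (rule ccontr)
      assume "\<sigma> i \<notin> S"
      moreover have "\<sigma> i \<in> {0..<n}"
        using that S permutes_in_image[OF \<sigma>] by blast
      ultimately have "\<sigma> (\<sigma> i) = \<sigma> i"
        using True by (metis Diff_iff)
      then have "\<sigma> i = i"
        using permutes_inj[OF \<sigma>] by (simp add: inj_eq)
      then show False using \<open>\<sigma> i \<notin> S\<close> that by simp
    qed
    then have "(\<Prod>i\<in>S. pad_identity S a i (\<sigma> i)) = (\<Prod>i\<in>S. a i (\<sigma> i))"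
      by (intro prod.cong) (auto simp: pad_identity_def)
    moreover have "(\<Prod>i\<in>{0..<n} - S. pad_identity S a i (\<sigma> i)) = 1"
      using True by (intro prod.neutral) (auto simp: pad_identity_def)
    moreover have "(\<Prod>i\<in>{0..<n} - S. if i = \<sigma> i then x else 0) = x ^ (n - card S)"
    proof -
      have "(\<Prod>i\<in>{0..<n} - S. if i = \<sigma> i then x else 0) = (\<Prod>i\<in>{0..<n} - S. x)"
        using True by (intro prod.cong) auto
      then show ?thesis
        using S by (simp add: card_Diff_subset finite_subset)
    qed
    moreover have "(\<Prod>i\<in>S. - a i (\<sigma> i)) = (-1) ^ card S * (\<Prod>i\<in>S. a i (\<sigma> i))"
      by (rule prod_uminus)
    ultimately show ?thesis
      by (simp add: split)
  next
    case False
    then obtain i where i: "i \<in> {0..<n} - S" "i \<noteq> \<sigma> i" by blast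
    then have "(\<Prod>i\<in>{0..<n} - S. if i = \<sigma> i then x else 0) = 0"
      by (intro prod_zero) auto
    moreover have "(\<Prod>i\<in>{0..<n} - S. pad_identity S a i (\<sigma> i)) = 0"
      using i by (intro prod_zero) (auto simp: pad_identity_def)
    ultimately show ?thesis
      unfolding split by (simp only: mult_zero_left mult_zero_right)
  qed
qed

text \<open>
  Two polynomials that agree at every complex number are equal, so the coefficients can be read off
  the expansion of \<open>imm (x I - A)\<close> into the terms of \<open>prod_characteristic_term\<close>. The signs
  \<open>(-1)\<^sup>r\<close> of the expansion and of the definition cancel.
\<close>

lemma immanant_coeff_eq_sum_padded:
  assumes A: "A \<in> carrier_mat n n" and r: "r \<le> n"
  shows "immanant_coeff lam r A = (\<Sum>S | S \<subseteq> {0..<n} \<and> card S = r. \<Sum>\<sigma>\<in>perms n.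
    sym_char lam \<sigma> * (\<Prod>i = 0..<n. pad_identity S (\<lambda>i j. A $$ (i, j)) i (\<sigma> i)))"
proof -
  define c where "c S = (\<Sum>\<sigma>\<in>perms n.
      sym_char lam \<sigma> * (\<Prod>i = 0..<n. pad_identity S (\<lambda>i j. A $$ (i, j)) i (\<sigma> i)))" for S
  define P where "P = (\<Sum>S\<in>Pow {0..<n}. monom ((-1) ^ card S * c S) (n - card S))"
  have "poly (immanant_poly lam A) x = poly P x" for x
  proof -
    have entry: "(x \<cdot>\<^sub>m 1\<^sub>m n - A) $$ (i, \<sigma> i) = - A $$ (i, \<sigma> i) + (if i = \<sigma> i then x else 0)"
      if "\<sigma> permutes {0..<n}" "i \<in> {0..<n}" for \<sigma> i
      using A that permutes_in_image[OF that(1), of i] by auto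
    have expand: "(\<Prod>i = 0..<n. (x \<cdot>\<^sub>m 1\<^sub>m n - A) $$ (i, \<sigma> i)) =
        (\<Sum>S\<in>Pow {0..<n}. (-1) ^ card S * x ^ (n - card S) * (\<Prod>i = 0..<n. pad_identity S (\<lambda>i j. A $$ (i, j)) i (\<sigma> i)))"
      if \<sigma>: "\<sigma> permutes {0..<n}" for \<sigma>
    proof -
      have "(\<Prod>i = 0..<n. (x \<cdot>\<^sub>m 1\<^sub>m n - A) $$ (i, \<sigma> i)) =
          (\<Prod>i = 0..<n. - A $$ (i, \<sigma> i) + (if i = \<sigma> i then x else 0))"
        by (rule prod.cong[OF refl]) (rule entry[OF \<sigma>])
      also have "\<dots> = (\<Sum>S\<in>Pow {0..<n}. (\<Prod>i\<in>S. - A $$ (i, \<sigma> i)) *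
          (\<Prod>i\<in>{0..<n} - S. if i = \<sigma> i then x else 0))"
        by (rule prod_add) simp
      also have "\<dots> = (\<Sum>S\<in>Pow {0..<n}. (-1) ^ card S * x ^ (n - card S) *
          (\<Prod>i = 0..<n. pad_identity S (\<lambda>i j. A $$ (i, j)) i (\<sigma> i)))"
        by (intro sum.cong refl prod_characteristic_term[OF \<sigma>, of _ "\<lambda>i j. A $$ (i, j)"]) simp
      finally show ?thesis .
    qed
    have "poly (immanant_poly lam A) x = (\<Sum>\<sigma>\<in>perms n. sym_char lam \<sigma> *
        (\<Prod>i = 0..<n. (x \<cdot>\<^sub>m 1\<^sub>m n - A) $$ (i, \<sigma> i)))"
      using A by (simp add: poly_immanant_poly_and_degree(1)[OF A] immanant_def)
    also have "\<dots> = (\<Sum>\<sigma>\<in>perms n. \<Sum>S\<in>Pow {0..<n}. (-1) ^ card S * x ^ (n - card S) *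
        (sym_char lam \<sigma> * (\<Prod>i = 0..<n. pad_identity S (\<lambda>i j. A $$ (i, j)) i (\<sigma> i))))"
      by (intro sum.cong refl) (simp add: expand sum_distrib_left mult.left_commute)
    also have "\<dots> = (\<Sum>S\<in>Pow {0..<n}. (-1) ^ card S * x ^ (n - card S) * c S)"
      by (subst sum.swap) (simp add: c_def sum_distrib_left)
    also have "\<dots> = poly P x"
      by (simp add: P_def poly_sum poly_monom mult_ac)
    finally show ?thesis .
  qed
  then have "immanant_poly lam A = P"
    by (simp add: poly_eq_poly_eq_iff[symmetric] fun_eq_iff)
  then have "immanant_coeff lam r A =
      (\<Sum>S\<in>Pow {0..<n}. (-1) ^ r * (if n - card S = n - r then (-1) ^ card S * c S else 0))"
    using A by (simp add: immanant_coeff_def P_def coeff_sum sum_distrib_left)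
  also have "\<dots> = (\<Sum>S\<in>Pow {0..<n}. if card S = r then c S else 0)"
  proof (intro sum.cong refl)
    fix S assume "S \<in> Pow {0..<n}"
    then have "card S \<le> n"
      using card_mono[of "{0..<n}" S] by simp
    then have "n - card S = n - r \<longleftrightarrow> card S = r"
      using r by auto
    then show "(-1) ^ r * (if n - card S = n - r then (-1) ^ card S * c S else 0) =
        (if card S = r then c S else 0)"
      by (simp add: mult.assoc[symmetric] power_mult_distrib[symmetric])
  qed
  also have "\<dots> = sum c {S \<in> Pow {0..<n}. card S = r}"
    by (rule sum.inter_filter[symmetric]) simp
  also have "{S \<in> Pow {0..<n}. card S = r} = {S. S \<subseteq> {0..<n} \<and> card S = r}"
    by auto
  finally show ?thesis
    by (simp add: c_def)
qed

text \<open>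
  Padding keeps a Gram matrix a Gram matrix: the vectors outside \<open>S\<close> are replaced by new unit vectors,
  orthogonal to everything else, for which the second summand of the index type makes room.
\<close>

lemma pad_identity_gram:
  fixes v :: "nat \<Rightarrow> 'x \<Rightarrow> complex"
  assumes X: "finite X" and v: "\<forall>i<n. \<forall>x. x \<notin> X \<longrightarrow> v i x = 0"
    and a: "\<forall>i<n. \<forall>j<n. a i j = inner_on X (v i) (v j)"
  obtains u :: "nat \<Rightarrow> 'x + nat \<Rightarrow> complex"
    where "\<forall>i<n. \<forall>x. x \<notin> X <+> {0..<n} \<longrightarrow> u i x = 0"
      and "\<forall>i<n. \<forall>j<n. pad_identity S a i j = inner_on (X <+> {0..<n}) (u i) (u j)"
proof
  define u :: "nat \<Rightarrow> 'x + nat \<Rightarrow> complex" where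
    "u i x = (case x of Inl y \<Rightarrow> if i \<in> S then v i y else 0 | Inr k \<Rightarrow> if i \<notin> S \<and> k = i then 1 else 0)" for i x
  show "\<forall>i<n. \<forall>x. x \<notin> X <+> {0..<n} \<longrightarrow> u i x = 0"
    using v by (auto simp: u_def split: sum.split)
  have "pad_identity S a i j = inner_on (X <+> {0..<n}) (u i) (u j)" if ij: "i < n" "j < n" for i j
  proof -
    have "inner_on (X <+> {0..<n}) (u i) (u j) =
        (\<Sum>x\<in>X. u i (Inl x) * cnj (u j (Inl x))) + (\<Sum>k\<in>{0..<n}. u i (Inr k) * cnj (u j (Inr k)))"
      unfolding inner_on_def using X by (subst sum.Plus) (simp_all add: o_def)
    also have "(\<Sum>x\<in>X. u i (Inl x) * cnj (u j (Inl x))) = (if i \<in> S \<and> j \<in> S then a i j else 0)"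
      using ij by (cases "i \<in> S"; cases "j \<in> S") (simp_all add: u_def a inner_on_def)
    also have "(\<Sum>k\<in>{0..<n}. u i (Inr k) * cnj (u j (Inr k))) =
        (\<Sum>k\<in>{0..<n}. if k = i then (if i \<notin> S \<and> j \<notin> S \<and> i = j then 1 else 0) else 0)"
      by (rule sum.cong) (auto simp: u_def)
    also have "\<dots> = (if i \<notin> S \<and> j \<notin> S \<and> i = j then 1 else 0)"
      using ij by (subst sum.delta) auto
    finally show ?thesis
      by (auto simp: pad_identity_def)
  qed
  then show "\<forall>i<n. \<forall>j<n. pad_identity S a i j = inner_on (X <+> {0..<n}) (u i) (u j)"
    by blast
qed

section \<open>Bounds from nonnegative diagonal products\<close>

text \<open>
  Along a permutation each \<open>\<epsilon> i\<close> occurs twice, once from its row and once from its column, so the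
  signs cancel.
\<close>

lemma prod_sign_balanced:
  fixes \<epsilon> :: "nat \<Rightarrow> complex" and b :: "nat \<Rightarrow> nat \<Rightarrow> real"
  assumes \<sigma>: "\<sigma> permutes {0..<n}"
    and a: "\<And>i j. i < n \<Longrightarrow> j < n \<Longrightarrow> a i j = \<epsilon> i * \<epsilon> j * of_real (b i j)"
    and \<epsilon>: "\<And>i. i < n \<Longrightarrow> \<epsilon> i * \<epsilon> i = 1"
  shows "(\<Prod>i = 0..<n. a i (\<sigma> i)) = of_real (\<Prod>i = 0..<n. b i (\<sigma> i))"
proof -
  have "(\<Prod>i = 0..<n. a i (\<sigma> i)) = (\<Prod>i = 0..<n. \<epsilon> i * \<epsilon> (\<sigma> i) * of_real (b i (\<sigma> i)))"
    using permutes_in_image[OF \<sigma>] by (intro prod.cong) (auto simp: a)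
  also have "\<dots> = (\<Prod>i = 0..<n. \<epsilon> i) * (\<Prod>i = 0..<n. \<epsilon> (\<sigma> i)) * of_real (\<Prod>i = 0..<n. b i (\<sigma> i))"
    by (simp add: prod.distrib)
  also have "(\<Prod>i = 0..<n. \<epsilon> (\<sigma> i)) = (\<Prod>i = 0..<n. \<epsilon> i)"
    using prod.permute[OF \<sigma>, of \<epsilon>] by (simp add: o_def)
  also have "(\<Prod>i = 0..<n. \<epsilon> i) * (\<Prod>i = 0..<n. \<epsilon> i) = 1"
    using \<epsilon> by (simp flip: prod.distrib)
  finally show ?thesis by simp
qed

text \<open>
  The lower bound is Schur's inequality. It also shows that the immanant is real, since in the order
  on complex numbers it lies above a real number. The upper bound then compares real parts term by
  term, which is possible as the diagonal products are nonnegative.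
\<close>

lemma normalized_immanant_bounds:
  fixes \<phi> :: "(nat \<Rightarrow> nat) \<Rightarrow> complex"
  assumes pd: "positive_definite n \<phi>" and pos: "0 < \<phi> id"
    and bounded: "\<And>\<sigma>. \<sigma> permutes {0..<n} \<Longrightarrow> Re (\<phi> \<sigma>) \<le> Re (\<phi> id)"
    and X: "finite X" and v: "\<forall>i<n. \<forall>x. x \<notin> X \<longrightarrow> v i x = 0"
    and A: "\<forall>i<n. \<forall>j<n. A i j = inner_on X (v i) (v j)"
    and nonneg: "\<And>\<sigma>. \<sigma> permutes {0..<n} \<Longrightarrow> 0 \<le> (\<Prod>i = 0..<n. A i (\<sigma> i))"
  shows "(\<Sum>\<sigma>\<in>perms n. of_int (sign \<sigma>) * (\<Prod>i = 0..<n. A i (\<sigma> i)))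
      \<le> (\<Sum>\<sigma>\<in>perms n. \<phi> \<sigma> * (\<Prod>i = 0..<n. A i (\<sigma> i))) / \<phi> id" (is "?det \<le> ?imm / _")
    and "(\<Sum>\<sigma>\<in>perms n. \<phi> \<sigma> * (\<Prod>i = 0..<n. A i (\<sigma> i))) / \<phi> id
      \<le> (\<Sum>\<sigma>\<in>perms n. \<Prod>i = 0..<n. A i (\<sigma> i))" (is "_ \<le> ?per")
proof -
  define d where "d = Re (\<phi> id)"
  have d: "\<phi> id = of_real d" "d > 0"
    using pos by (simp_all add: d_def less_complex_def complex_eq_iff)
  define p where "p \<sigma> = Re (\<Prod>i = 0..<n. A i (\<sigma> i))" for \<sigma>
  have p: "(\<Prod>i = 0..<n. A i (\<sigma> i)) = of_real (p \<sigma>)" "p \<sigma> \<ge> 0" if "\<sigma> permutes {0..<n}" for \<sigma>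
    using nonneg[OF that] by (simp_all add: p_def less_eq_complex_def complex_eq_iff)
  have "\<phi> id * ?det \<le> ?imm"
    by (rule schur_dominance[OF pd X v A])
  moreover have det_real: "Im ?det = 0"
    by (simp add: p)
  ultimately have lower: "d * Re ?det \<le> Re ?imm" and imm_real: "Im ?imm = 0"
    by (simp_all only: d less_eq_complex_def times_complex.sel Re_complex_of_real Im_complex_of_real)
      simp_all
  have divide: "a \<le> b / \<phi> id" "b / \<phi> id \<le> c"
    if "d * Re a \<le> Re b" "Re b \<le> d * Re c" "Im a = 0" "Im b = 0" "Im c = 0" for a b c
    using that d(2) by (simp_all add: d less_eq_complex_def field_simps)
  have "Re ?imm = (\<Sum>\<sigma>\<in>perms n. Re (\<phi> \<sigma>) * p \<sigma>)"
    by (simp add: p)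
  also have "\<dots> \<le> (\<Sum>\<sigma>\<in>perms n. d * p \<sigma>)"
    using bounded p(2) d(1) by (intro sum_mono mult_right_mono) auto
  also have "\<dots> = d * Re ?per"
    by (simp add: p sum_distrib_left)
  finally have "Re ?imm \<le> d * Re ?per" .
  moreover have "Im ?per = 0"
    by (simp add: p)
  ultimately show "?det \<le> ?imm / \<phi> id" "?imm / \<phi> id \<le> ?per"
    using divide[OF lower _ det_real imm_real] by blast+
qed

section \<open>The Laplacian of a bipartite graph\<close>

lemma card_out_neighbours:
  assumes "graph G"
  shows "card {w. x \<rightarrow>\<^bsub>G\<^esub> w} = out_degree G x"
proof -
  interpret graph G by fact
  have "{w. x \<rightarrow>\<^bsub>G\<^esub> w} = head G ` out_arcs G x"
    by (auto simp: arcs_ends_def arc_to_ends_def out_arcs_def image_iff)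
  moreover have "inj_on (head G) (out_arcs G x)"
    by (rule inj_onI) (auto simp: out_arcs_def intro!: no_multi_arcs simp: arc_to_ends_def)
  ultimately show ?thesis
    by (simp add: out_degree_def card_image)
qed

lemma laplacian_entry:
  assumes "graph G" and "distinct vs" and "i < length vs" and "j < length vs"
  shows "laplacian G vs $$ (i, j) = (if i = j then of_nat (out_degree G (vs ! i))
    else if vs ! i \<rightarrow>\<^bsub>G\<^esub> vs ! j then - 1 else 0)"
proof -
  interpret graph G by fact
  have "\<not> x \<rightarrow>\<^bsub>G\<^esub> x" for x
    using no_loops by (auto simp: arcs_ends_def arc_to_ends_def)
  then show ?thesis
    using assms by (simp add: laplacian_def degree_mat_def adjacency_mat_def)
qed

text \<open>
  The vectors are the rows of the incidence matrix in which every edge is oriented from \<open>U\<close> to \<open>W\<close>.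
  The set \<open>X\<close> thus contains exactly one of the two orientations of every edge, and no factor \<open>2\<close> arises.
\<close>

lemma laplacian_gram:
  assumes G: "graph G" and UW: "U \<inter> W = {}"
    and bip: "\<And>u w. u \<rightarrow>\<^bsub>G\<^esub> w \<Longrightarrow> u \<in> U \<and> w \<in> W \<or> u \<in> W \<and> w \<in> U"
    and vs: "distinct vs" "i < length vs" "j < length vs"
    and X: "X = {(u, w). u \<rightarrow>\<^bsub>G\<^esub> w \<and> u \<in> U}"
  shows "laplacian G vs $$ (i, j) = inner_on X
    (\<lambda>(u, w). of_bool (u = vs ! i) - of_bool (w = vs ! i))
    (\<lambda>(u, w). of_bool (u = vs ! j) - of_bool (w = vs ! j))"
proof -
  interpret graph G by fact
  have sym: "u \<rightarrow>\<^bsub>G\<^esub> w \<longleftrightarrow> w \<rightarrow>\<^bsub>G\<^esub> u" for u w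
    using graph_symmetric by blast
  have "X \<subseteq> arcs_ends G"
    by (auto simp: X)
  then have fin: "finite X"
    by (rule finite_subset) (simp add: arcs_ends_def)
  let ?x = "vs ! i" and ?y = "vs ! j"
  have product: "(of_bool a - of_bool b) * cnj (of_bool c - of_bool d) =
      of_bool (a \<and> c) + of_bool (b \<and> d) - of_bool (a \<and> d) - of_bool (b \<and> c)" for a b c d
    by (cases a; cases b; cases c; cases d) simp_all
  have count: "(\<Sum>z\<in>X. of_bool (Q z)) = of_nat (card {z \<in> X. Q z})" for Q :: "_ \<Rightarrow> bool"
    using fin by (simp add: Int_def)
  have "inner_on X (\<lambda>(u, w). of_bool (u = ?x) - of_bool (w = ?x)) (\<lambda>(u, w). of_bool (u = ?y) - of_bool (w = ?y)) =
      (\<Sum>z\<in>X. of_bool (fst z = ?x \<and> fst z = ?y) + of_bool (snd z = ?x \<and> snd z = ?y)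
        - of_bool (fst z = ?x \<and> snd z = ?y) - of_bool (snd z = ?x \<and> fst z = ?y))"
    unfolding inner_on_def case_prod_beta by (rule sum.cong[OF refl]) (rule product)
  also have "\<dots> = of_nat (card {z \<in> X. fst z = ?x \<and> fst z = ?y}) + of_nat (card {z \<in> X. snd z = ?x \<and> snd z = ?y})
      - of_nat (card {z \<in> X. fst z = ?x \<and> snd z = ?y}) - of_nat (card {z \<in> X. snd z = ?x \<and> fst z = ?y})"
    by (simp only: sum.distrib sum_subtractf count)
  also have "\<dots> = laplacian G vs $$ (i, j)"
  proof (cases "i = j")
    case True
    have "{z \<in> X. fst z = ?x \<and> snd z = ?x} = {}"
      using bip UW by (auto simp: X)
    moreover have "{z \<in> X. snd z = ?x \<and> fst z = ?x} = {}"
      using bip UW by (auto simp: X)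
    moreover have "card {z \<in> X. fst z = ?x} + card {z \<in> X. snd z = ?x} = out_degree G ?x"
    proof (cases "?x \<in> U")
      case True
      have "{z \<in> X. fst z = ?x} = Pair ?x ` {w. ?x \<rightarrow>\<^bsub>G\<^esub> w}" "{z \<in> X. snd z = ?x} = {}"
        using bip UW True by (auto simp: X)
      moreover have "card (Pair ?x ` {w. ?x \<rightarrow>\<^bsub>G\<^esub> w}) = out_degree G ?x"
        by (simp add: card_image inj_on_def card_out_neighbours[OF G])
      ultimately show ?thesis
        by (simp only: card.empty add_0_right)
    next
      case False
      have "{z \<in> X. snd z = ?x} = (\<lambda>u. (u, ?x)) ` {w. ?x \<rightarrow>\<^bsub>G\<^esub> w}" "{z \<in> X. fst z = ?x} = {}"
        using bip UW False sym by (auto simp: X)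
      moreover have "card ((\<lambda>u. (u, ?x)) ` {w. ?x \<rightarrow>\<^bsub>G\<^esub> w}) = out_degree G ?x"
        by (simp add: card_image inj_on_def card_out_neighbours[OF G])
      ultimately show ?thesis
        by (simp only: card.empty add_0)
    qed
    ultimately show ?thesis
      unfolding True[symmetric] laplacian_entry[OF G vs(1,2,2)]
      by (simp only: conj_absorb card.empty of_nat_0 diff_0_right simp_thms if_True flip: of_nat_add)
  next
    case False
    then have xy: "?x \<noteq> ?y"
      using vs by (simp add: nth_eq_iff_index_eq)
    have disjoint: "{z \<in> X. fst z = ?x \<and> fst z = ?y} = {}" "{z \<in> X. snd z = ?x \<and> snd z = ?y} = {}"
      using xy by auto
    have forward: "{z \<in> X. fst z = ?x \<and> snd z = ?y} =
        (if ?x \<rightarrow>\<^bsub>G\<^esub> ?y \<and> ?x \<in> U then {(?x, ?y)} else {})"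
      by (auto simp: X)
    have backward: "{z \<in> X. snd z = ?x \<and> fst z = ?y} =
        (if ?x \<rightarrow>\<^bsub>G\<^esub> ?y \<and> ?y \<in> U then {(?y, ?x)} else {})"
      using sym by (auto simp: X)
    have "?x \<rightarrow>\<^bsub>G\<^esub> ?y \<Longrightarrow> (?x \<in> U) \<noteq> (?y \<in> U)"
      using bip UW by blast
    then show ?thesis
      unfolding disjoint forward backward laplacian_entry[OF G vs] using False by auto
  qed
  finally show ?thesis ..
qed

theorem theorem10:
  fixes G :: "('a, 'b) pre_digraph" and vs :: "'a list" and n :: nat and lam :: "nat list" and r :: nat
  assumes "graph G" and "Digraph_Component.connected G" and "bipartite G"
    and "distinct vs" and "set vs = verts G" and "length vs = n"
    and "is_partition n lam"
    and "r \<le> n"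
  shows "immanant_coeff (replicate n 1) r (laplacian G vs)
           \<le> immanant_coeff lam r (laplacian G vs) / sym_char lam id
         \<and> immanant_coeff lam r (laplacian G vs) / sym_char lam id
           \<le> immanant_coeff [n] r (laplacian G vs)"
proof -
  have lam: "sum_list lam = n"
    using assms(7) by (simp add: is_partition_def)
  obtain U W where UW: "U \<inter> W = {}"
    and bip: "\<And>u w. u \<rightarrow>\<^bsub>G\<^esub> w \<Longrightarrow> u \<in> U \<and> w \<in> W \<or> u \<in> W \<and> w \<in> U"
    using assms(3) unfolding bipartite_def by blast
  interpret graph G by fact
  define L where "L i j = laplacian G vs $$ (i, j)" for i j
  define X where "X = {(u, w). u \<rightarrow>\<^bsub>G\<^esub> w \<and> u \<in> U}"
  define v :: "nat \<Rightarrow> 'a \<times> 'a \<Rightarrow> complex" where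
    "v i z = (if z \<in> X then of_bool (fst z = vs ! i) - of_bool (snd z = vs ! i) else 0)" for i z
  have "X \<subseteq> arcs_ends G"
    by (auto simp: X_def)
  then have X: "finite X"
    by (rule finite_subset) (simp add: arcs_ends_def)
  have v: "\<forall>i<n. \<forall>z. z \<notin> X \<longrightarrow> v i z = 0"
    by (simp add: v_def)
  have gram: "\<forall>i<n. \<forall>j<n. L i j = inner_on X (v i) (v j)"
    using laplacian_gram[OF assms(1) UW bip assms(4) _ _ X_def] assms(6)
    by (simp add: L_def inner_on_def v_def case_prod_beta)
  \<comment> \<open>edges join the two classes, so \<open>\<epsilon> i * \<epsilon> j\<close> is \<open>-1\<close> on every edge and \<open>1\<close> on the diagonal\<close>
  define \<epsilon> :: "nat \<Rightarrow> complex" where "\<epsilon> i = (if vs ! i \<in> U then 1 else - 1)" for i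
  have L_signed: "L i j = \<epsilon> i * \<epsilon> j * of_real (if i = j then out_degree G (vs ! i)
      else if vs ! i \<rightarrow>\<^bsub>G\<^esub> vs ! j then 1 else 0)" if "i < n" "j < n" for i j
    using laplacian_entry[OF assms(1,4), of i j] that assms(6) bip[of "vs ! i" "vs ! j"] UW
    by (auto simp: L_def \<epsilon>_def)
  have nonneg: "0 \<le> (\<Prod>i = 0..<n. pad_identity S L i (\<sigma> i))" if \<sigma>: "\<sigma> permutes {0..<n}" for S \<sigma>
  proof -
    define b :: "nat \<Rightarrow> nat \<Rightarrow> real" where
      "b i j = (if i \<in> S \<and> j \<in> S then if i = j then out_degree G (vs ! i)
        else if vs ! i \<rightarrow>\<^bsub>G\<^esub> vs ! j then 1 else 0 else if i = j then 1 else 0)" for i j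
    have "(\<Prod>i = 0..<n. pad_identity S L i (\<sigma> i)) = of_real (\<Prod>i = 0..<n. b i (\<sigma> i))"
    proof (rule prod_sign_balanced[OF \<sigma>])
      show "pad_identity S L i j = \<epsilon> i * \<epsilon> j * of_real (b i j)" if "i < n" "j < n" for i j
        using L_signed[OF that] by (auto simp: pad_identity_def b_def \<epsilon>_def)
    qed (simp add: \<epsilon>_def)
    moreover have "0 \<le> (\<Prod>i = 0..<n. b i (\<sigma> i))"
      by (rule prod_nonneg) (simp add: b_def)
    ultimately show ?thesis
      by (simp add: less_eq_complex_def del: of_real_prod)
  qed
  have bounds: "(\<Sum>\<sigma>\<in>perms n. of_int (sign \<sigma>) * (\<Prod>i = 0..<n. pad_identity S L i (\<sigma> i)))
        \<le> (\<Sum>\<sigma>\<in>perms n. sym_char lam \<sigma> * (\<Prod>i = 0..<n. pad_identity S L i (\<sigma> i))) / sym_char lam id"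
      "(\<Sum>\<sigma>\<in>perms n. sym_char lam \<sigma> * (\<Prod>i = 0..<n. pad_identity S L i (\<sigma> i))) / sym_char lam id
        \<le> (\<Sum>\<sigma>\<in>perms n. \<Prod>i = 0..<n. pad_identity S L i (\<sigma> i))" for S
  proof -
    obtain u :: "nat \<Rightarrow> ('a \<times> 'a) + nat \<Rightarrow> complex"
      where u: "\<forall>i<n. \<forall>x. x \<notin> X <+> {0..<n} \<longrightarrow> u i x = 0"
        and padded_u: "\<forall>i<n. \<forall>j<n. pad_identity S L i j = inner_on (X <+> {0..<n}) (u i) (u j)"
      using pad_identity_gram[OF X v gram] .
    have pd: "positive_definite n (sym_char lam)"
      using positive_definite_sym_char[of lam] by (simp only: lam)
    have bounded: "Re (sym_char lam \<sigma>) \<le> Re (sym_char lam id)" if "\<sigma> permutes {0..<n}" for \<sigma>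
      by (rule Re_sym_char_le) (simp add: lam that)
    have fin: "finite (X <+> {0..<n})"
      using X by simp
    show "(\<Sum>\<sigma>\<in>perms n. of_int (sign \<sigma>) * (\<Prod>i = 0..<n. pad_identity S L i (\<sigma> i)))
        \<le> (\<Sum>\<sigma>\<in>perms n. sym_char lam \<sigma> * (\<Prod>i = 0..<n. pad_identity S L i (\<sigma> i))) / sym_char lam id"
      by (rule normalized_immanant_bounds(1)[OF pd sym_char_id_pos bounded fin u padded_u nonneg])
    show "(\<Sum>\<sigma>\<in>perms n. sym_char lam \<sigma> * (\<Prod>i = 0..<n. pad_identity S L i (\<sigma> i))) / sym_char lam id
        \<le> (\<Sum>\<sigma>\<in>perms n. \<Prod>i = 0..<n. pad_identity S L i (\<sigma> i))"
      by (rule normalized_immanant_bounds(2)[OF pd sym_char_id_pos bounded fin u padded_u nonneg])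
  qed
  have carrier: "laplacian G vs \<in> carrier_mat n n"
    using assms(6) by (intro carrier_matI) (simp_all add: laplacian_def adjacency_mat_def)
  note coeff = immanant_coeff_eq_sum_padded[OF carrier assms(8), folded L_def]
  have column: "immanant_coeff (replicate n 1) r (laplacian G vs) =
      (\<Sum>S | S \<subseteq> {0..<n} \<and> card S = r. \<Sum>\<sigma>\<in>perms n. of_int (sign \<sigma>) * (\<Prod>i = 0..<n. pad_identity S L i (\<sigma> i)))"
    unfolding coeff by (intro sum.cong refl) (simp add: sym_char_column del: One_nat_def)
  have row: "immanant_coeff [n] r (laplacian G vs) =
      (\<Sum>S | S \<subseteq> {0..<n} \<and> card S = r. \<Sum>\<sigma>\<in>perms n. \<Prod>i = 0..<n. pad_identity S L i (\<sigma> i))"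
    unfolding coeff by (intro sum.cong refl) (simp add: sym_char_row)
  show ?thesis
    unfolding column row coeff[of lam]
    by (intro conjI; subst sum_divide_distrib; rule sum_mono; rule bounds)
qed

end
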